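(* Let $a,c\in\mathbb{R}^*$ with $a\,c>0$. Then there exists a two-parameter family of generalized Ricci metrics $\{d\sigma_{m,\ell}^2\}$ of type $(a,0,c)$ on $\mathbb{R}^2$ that possess rotational symmetry, given by $$d\sigma_{m,\ell}^2=ds^2+f_{m,\ell}(s)^2\,dt^2,$$ where $f_{m,\ell}$ is the positive $T_{m,\ell}$-periodic solution of the equation $f''=m\,f^{1-a}-c\,f$ with energy $\ell$, and the parameters $m,\ell\in\mathbb{R}$ range over all pairs with $c\,m>0$ and $\min_{x>0}P_m(x)<\ell<\lim_{x\to0^+}P_m(x)$. In addition, given $(\gamma_1,\gamma_2)\in\mathbb{R}\times\mathbb{R}^*$, the torus $\mathbb{R}^2/\Gamma_{T_{m,\ell}}(\gamma_1,\gamma_2)$ endowed with the metric $d\sigma_{m,\ell}^2$ is a generalized Ricci torus of type $(a,0,c)$.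
   Context: $\mathbb{R}^*=\mathbb{R}\setminus\{0\}$. For $(a,b,c)\in\mathbb{R}^3$, a Riemannian metric on a smooth connected surface is a generalized Ricci metric of type $(a,b,c)$ if its Gaussian curvature $K$ satisfies $(K-c)\Delta K-|\nabla K|^2-(aK+b)(K-c)^2=0$, with $\nabla$, $\Delta$ the gradient and Laplace–Beltrami operator of the metric; the surface with this metric is then called a generalized Ricci surface (torus, if it is a torus) of type $(a,b,c)$. A metric of the warped form $ds^2+f(s)^2dt^2$, $f>0$, is said to possess rotational symmetry. The potential is, for $x>0$, $$P_m(x)=-m\log x+\frac{c\,x^2}{2}\ \text{ if } a=2,\qquad P_m(x)=-\frac{m\,x^{2-a}}{2-a}+\frac{c\,x^2}{2}\ \text{ if } a\neq2,$$ and a positive solution $f$ of $f''=m\,f^{1-a}-c\,f$ has energy $\ell$ if $\frac12 (f')^2+P_m(f)=\ell$. The function $f_{m,\ell}:\mathbb{R}\to(0,\infty)$ denotes the periodic solution (determined up to translation of the variable $s$) such that $(f_{m,\ell},f_{m,\ell}')$ lies in the level set $\{(x,y): x>0,\ y^2/2+P_m(x)=\ell\}$, and $T_{m,\ell}>0$ is its minimal period. The lattice is $\Gamma_{T_{m,\ell}}(\gamma_1,\gamma_2)=(T_{m,\ell},\gamma_1)\mathbb{Z}\oplus(0,\gamma_2)\mathbb{Z}\subset\mathbb{R}^2$, acting on $\mathbb{R}^2$ (coordinates $(s,t)$) by translations, and the torus carries the metric induced on the quotient. *)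

theory Defs
  imports "HOL-Analysis.Analysis"
begin

section \<open>Smooth functions on open subsets of the coordinate plane\<close>

definition partial :: "2 \<Rightarrow> (real^2 \<Rightarrow> real) \<Rightarrow> real^2 \<Rightarrow> real" where
  "partial i u x = frechet_derivative u (at x) (axis i 1)"

text \<open>Meant for open \<open>S\<close>: \<open>u\<close> is of class \<open>C\<^sup>k\<close> iff it is differentiable with partial
  derivatives of class \<open>C\<^sup>k\<^sup>-\<^sup>1\<close>.\<close>

primrec C_k_on :: "nat \<Rightarrow> (real^2) set \<Rightarrow> (real^2 \<Rightarrow> real) \<Rightarrow> bool" where
  "C_k_on 0 S u \<longleftrightarrow> continuous_on S u"
| "C_k_on (Suc k) S u \<longleftrightarrow> (\<forall>x\<in>S. u differentiable (at x)) \<and> (\<forall>i. C_k_on k S (partial i u))"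

definition smooth_on :: "(real^2) set \<Rightarrow> (real^2 \<Rightarrow> real) \<Rightarrow> bool" where
  "smooth_on S u \<longleftrightarrow> (\<forall>k. C_k_on k S u)"

definition smooth_map_on :: "(real^2) set \<Rightarrow> (real^2 \<Rightarrow> real^2) \<Rightarrow> bool" where
  "smooth_map_on S F \<longleftrightarrow> (\<forall>i. smooth_on S (\<lambda>x. F x $ i))"


section \<open>Local Riemannian geometry\<close>

text \<open>A metric in local coordinates is the matrix-valued function of its components.\<close>

type_synonym local_metric = "real^2 \<Rightarrow> real^2^2"

definition christoffel :: "local_metric \<Rightarrow> 2 \<Rightarrow> 2 \<Rightarrow> 2 \<Rightarrow> real^2 \<Rightarrow> real" where
  "christoffel g k i j x =
     (\<Sum>l\<in>UNIV. matrix_inv (g x) $ k $ l *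
        (partial i (\<lambda>y. g y $ j $ l) x + partial j (\<lambda>y. g y $ i $ l) x
          - partial l (\<lambda>y. g y $ i $ j) x)) / 2"

text \<open>The \<open>l\<close>-th component of \<open>R(\<partial>\<^sub>i,\<partial>\<^sub>j)\<partial>\<^sub>k = \<nabla>\<^sub>i\<nabla>\<^sub>j\<partial>\<^sub>k - \<nabla>\<^sub>j\<nabla>\<^sub>i\<partial>\<^sub>k\<close>.\<close>

definition riemann_tensor :: "local_metric \<Rightarrow> 2 \<Rightarrow> 2 \<Rightarrow> 2 \<Rightarrow> 2 \<Rightarrow> real^2 \<Rightarrow> real" where
  "riemann_tensor g l i j k x =
     partial i (christoffel g l j k) x - partial j (christoffel g l i k) x
     + (\<Sum>r\<in>UNIV. christoffel g r j k x * christoffel g l i r x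
                  - christoffel g r i k x * christoffel g l j r x)"

text \<open>\<open>K = \<langle>R(\<partial>\<^sub>1,\<partial>\<^sub>2)\<partial>\<^sub>2, \<partial>\<^sub>1\<rangle> / det g\<close>; positive on round spheres.\<close>

definition gauss_curvature :: "local_metric \<Rightarrow> real^2 \<Rightarrow> real" where
  "gauss_curvature g x = (\<Sum>l\<in>UNIV. riemann_tensor g l 1 2 2 x * g x $ l $ 1) / det (g x)"

definition gradient :: "local_metric \<Rightarrow> (real^2 \<Rightarrow> real) \<Rightarrow> real^2 \<Rightarrow> real^2" where
  "gradient g u x = matrix_inv (g x) *v (\<chi> i. partial i u x)"

definition norm_sq :: "local_metric \<Rightarrow> real^2 \<Rightarrow> real^2 \<Rightarrow> real" where
  "norm_sq g x v = v \<bullet> (g x *v v)"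

definition divergence :: "local_metric \<Rightarrow> (real^2 \<Rightarrow> real^2) \<Rightarrow> real^2 \<Rightarrow> real" where
  "divergence g X x =
     (\<Sum>i\<in>UNIV. partial i (\<lambda>y. sqrt (det (g y)) * X y $ i) x) / sqrt (det (g x))"

definition laplace_beltrami :: "local_metric \<Rightarrow> (real^2 \<Rightarrow> real) \<Rightarrow> real^2 \<Rightarrow> real" where
  "laplace_beltrami g u = divergence g (gradient g u)"

definition pullback_metric :: "(real^2 \<Rightarrow> real^2) \<Rightarrow> local_metric \<Rightarrow> local_metric" where
  "pullback_metric F h x =
     transpose (jacobian F (at x)) ** h (F x) ** jacobian F (at x)"


section \<open>Riemannian surfaces\<close>

text \<open>A chart is its domain together with its coordinate map, of which only the values on the
  domain matter. An atlas need not be maximal.\<close>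

type_synonym 'a chart = "'a set \<times> ('a \<Rightarrow> real^2)"

definition smooth_surface :: "'a topology \<Rightarrow> 'a chart set \<Rightarrow> bool" where
  "smooth_surface M A \<longleftrightarrow>
     Hausdorff_space M \<and> second_countable M \<and> connected_space M \<and>
     (\<Union>(U, \<phi>)\<in>A. U) = topspace M \<and>
     (\<forall>(U, \<phi>)\<in>A. openin M U \<and> open (\<phi> ` U) \<and>
        homeomorphic_map (subtopology M U) (top_of_set (\<phi> ` U)) \<phi>) \<and>
     (\<forall>(U, \<phi>)\<in>A. \<forall>(V, \<psi>)\<in>A. smooth_map_on (\<phi> ` (U \<inter> V)) (\<psi> \<circ> inv_into U \<phi>))"

text \<open>A metric on a surface is given by its components in each chart, subject to the
  transformation law of a covariant 2-tensor.\<close>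

type_synonym 'a metric_tensor = "'a chart \<Rightarrow> local_metric"

definition riemannian_metric :: "'a chart set \<Rightarrow> 'a metric_tensor \<Rightarrow> bool" where
  "riemannian_metric A g \<longleftrightarrow>
     (\<forall>(U, \<phi>)\<in>A.
        (\<forall>i j. smooth_on (\<phi> ` U) (\<lambda>x. g (U, \<phi>) x $ i $ j)) \<and>
        (\<forall>x\<in>\<phi> ` U. transpose (g (U, \<phi>) x) = g (U, \<phi>) x \<and>
           (\<forall>v. v \<noteq> 0 \<longrightarrow> 0 < v \<bullet> (g (U, \<phi>) x *v v)))) \<and>
     (\<forall>(U, \<phi>)\<in>A. \<forall>(V, \<psi>)\<in>A. \<forall>x\<in>\<phi> ` (U \<inter> V).
        g (U, \<phi>) x = pullback_metric (\<psi> \<circ> inv_into U \<phi>) (g (V, \<psi>)) x)"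

definition local_isometry ::
  "'a topology \<Rightarrow> 'a chart set \<Rightarrow> 'a metric_tensor \<Rightarrow>
   'b topology \<Rightarrow> 'b chart set \<Rightarrow> 'b metric_tensor \<Rightarrow> ('a \<Rightarrow> 'b) \<Rightarrow> bool" where
  "local_isometry M A g N B h F \<longleftrightarrow>
     continuous_map M N F \<and>
     (\<forall>(U, \<phi>)\<in>A. \<forall>(V, \<psi>)\<in>B.
        smooth_map_on (\<phi> ` (U \<inter> F -` V)) (\<psi> \<circ> F \<circ> inv_into U \<phi>) \<and>
        (\<forall>x\<in>\<phi> ` (U \<inter> F -` V).
           g (U, \<phi>) x = pullback_metric (\<psi> \<circ> F \<circ> inv_into U \<phi>) (h (V, \<psi>)) x))"

definition ricci_equation :: "real \<Rightarrow> real \<Rightarrow> real \<Rightarrow> local_metric \<Rightarrow> real^2 \<Rightarrow> bool" where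
  "ricci_equation a b c g x \<longleftrightarrow>
     (let K = gauss_curvature g in
        (K x - c) * laplace_beltrami g K x - norm_sq g x (gradient g K x)
          - (a * K x + b) * (K x - c)\<^sup>2 = 0)"

text \<open>Curvature, gradient and Laplacian are invariant under coordinate changes, so the equation
  may be stated in the charts of the atlas.\<close>

definition generalized_ricci_surface ::
  "real \<Rightarrow> real \<Rightarrow> real \<Rightarrow> 'a topology \<Rightarrow> 'a chart set \<Rightarrow> 'a metric_tensor \<Rightarrow> bool" where
  "generalized_ricci_surface a b c M A g \<longleftrightarrow>
     smooth_surface M A \<and> riemannian_metric A g \<and>
     (\<forall>(U, \<phi>)\<in>A. \<forall>x\<in>\<phi> ` U. ricci_equation a b c (g (U, \<phi>)) x)"

definition torus_topology :: "(complex \<times> complex) topology" where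
  "torus_topology = prod_topology (top_of_set (sphere 0 1)) (top_of_set (sphere 0 1))"

definition generalized_ricci_torus ::
  "real \<Rightarrow> real \<Rightarrow> real \<Rightarrow> 'a topology \<Rightarrow> 'a chart set \<Rightarrow> 'a metric_tensor \<Rightarrow> bool" where
  "generalized_ricci_torus a b c M A g \<longleftrightarrow>
     generalized_ricci_surface a b c M A g \<and> M homeomorphic_space torus_topology"


section \<open>The plane with a warped metric\<close>

text \<open>The coordinates \<open>(s, t)\<close> of a point \<open>p\<close> are \<open>(p $ 1, p $ 2)\<close>.\<close>

definition plane_atlas :: "(real^2) chart set" where
  "plane_atlas = {(UNIV, id)}"

definition plane_metric :: "local_metric \<Rightarrow> (real^2) metric_tensor" where
  "plane_metric \<sigma> = (\<lambda>_. \<sigma>)"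

definition warped_metric :: "(real \<Rightarrow> real) \<Rightarrow> local_metric" where
  "warped_metric f p = vector [vector [1, 0], vector [0, (f (p $ 1))\<^sup>2]]"

definition rotational_symmetry :: "local_metric \<Rightarrow> bool" where
  "rotational_symmetry \<sigma> \<longleftrightarrow> (\<exists>f. (\<forall>s. 0 < f s) \<and> \<sigma> = warped_metric f)"


section \<open>Quotients of the plane by a lattice of translations\<close>

definition lattice :: "real \<Rightarrow> real \<Rightarrow> real \<Rightarrow> (real^2) set" where
  "lattice T \<gamma>1 \<gamma>2 =
     {of_int j *\<^sub>R vector [T, \<gamma>1] + of_int k *\<^sub>R vector [0, \<gamma>2] | j k :: int. True}"

definition coset_proj :: "(real^2) set \<Rightarrow> real^2 \<Rightarrow> (real^2) set" where
  "coset_proj \<Gamma> x = (\<lambda>\<gamma>. x + \<gamma>) ` \<Gamma>"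

definition quotient_plane :: "(real^2) set \<Rightarrow> (real^2) set topology" where
  "quotient_plane \<Gamma> = topology (\<lambda>W. W \<subseteq> range (coset_proj \<Gamma>) \<and> open (coset_proj \<Gamma> -` W))"

text \<open>The charts are the local inverses of the projection.\<close>

definition quotient_atlas :: "(real^2) set \<Rightarrow> (real^2) set chart set" where
  "quotient_atlas \<Gamma> =
     {(coset_proj \<Gamma> ` V, inv_into V (coset_proj \<Gamma>)) | V. open V \<and> inj_on (coset_proj \<Gamma>) V}"

text \<open>Since the charts are local inverses of the projection, the metric induced by a
  \<open>\<Gamma>\<close>-invariant metric has the same components in every chart. Without invariance, the
  transformation law in \<^const>\<open>riemannian_metric\<close> fails.\<close>

definition quotient_metric :: "local_metric \<Rightarrow> (real^2) set metric_tensor" where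
  "quotient_metric \<sigma> = (\<lambda>_. \<sigma>)"


section \<open>The potential and the periodic solutions\<close>

definition potential :: "real \<Rightarrow> real \<Rightarrow> real \<Rightarrow> real \<Rightarrow> real" where
  "potential a c m x =
     (if a = 2 then - m * ln x + c * x\<^sup>2 / 2
      else - m * x powr (2 - a) / (2 - a) + c * x\<^sup>2 / 2)"

text \<open>The limit of the potential at \<open>0\<close> may be infinite, hence the extended reals.\<close>

definition admissible :: "real \<Rightarrow> real \<Rightarrow> real \<Rightarrow> real \<Rightarrow> bool" where
  "admissible a c m l \<longleftrightarrow>
     0 < c * m \<and>
     (LEAST v. v \<in> potential a c m ` {0<..}) < l \<and>
     ereal l < Lim (at_right 0) (\<lambda>x. ereal (potential a c m x))"

definition minimal_period :: "(real \<Rightarrow> real) \<Rightarrow> real \<Rightarrow> bool" where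
  "minimal_period f T \<longleftrightarrow>
     0 < T \<and> (\<forall>s. f (s + T) = f s) \<and> (\<forall>T'. 0 < T' \<and> T' < T \<longrightarrow> (\<exists>s. f (s + T') \<noteq> f s))"

text \<open>\<open>f\<close> is (a translate of) \<open>f\<^bsub>m,l\<^esub>\<close> and \<open>T\<close> is \<open>T\<^bsub>m,l\<^esub>\<close>.\<close>

definition periodic_solution ::
  "real \<Rightarrow> real \<Rightarrow> real \<Rightarrow> real \<Rightarrow> (real \<Rightarrow> real) \<Rightarrow> real \<Rightarrow> bool" where
  "periodic_solution a c m l f T \<longleftrightarrow>
     (\<forall>s. 0 < f s) \<and>
     (\<forall>s. (f has_real_derivative deriv f s) (at s)) \<and>
     (\<forall>s. (deriv f has_real_derivative m * f s powr (1 - a) - c * f s) (at s)) \<and>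
     (\<forall>s. (deriv f s)\<^sup>2 / 2 + potential a c m (f s) = l) \<and>
     minimal_period f T"

end

theory Submission
  imports Defs
begin

text \<open>
  For a warped metric \<open>ds\<^sup>2 + f(s)\<^sup>2 dt\<^sup>2\<close> the Gaussian curvature is \<open>K = - f'' / f\<close>, and the equation
  \<open>f'' = m f\<^bsup>1-a\<^esup> - c f\<close> says precisely that \<open>K - c = - m f\<^bsup>-a\<^esup>\<close>. The Ricci equation of type \<open>(a, 0, c)\<close>
  is, away from the zeros of \<open>K - c\<close>, the equation \<open>\<Delta> log \<bar>K - c\<bar> = a K\<close>; it holds because
  \<open>\<Delta> log f = - K\<close> (\<open>ricci_equation_warped_metric\<close>). So every positive solution gives a generalized
  Ricci metric, and the remaining questions are the existence of periodic solutions and the passage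
  to the quotient.

  The equation is Newton's equation for the given potential. As \<open>a\<close>, \<open>c\<close> and \<open>m\<close> have the same
  sign, the potential decreases to its minimum and then increases to infinity, so an admissible energy
  is attained at exactly two points, with nonzero slope (\<open>admissible_well\<close>). The motion between them
  is constructed by integrating the energy equation in an angular variable in which the turning points
  are not singular; it is periodic, and the time for one turn is the minimal period
  (\<open>well_oscillation\<close>). Conversely a periodic solution of that energy reaches the upper turning point
  at rest, so it is a translate of the constructed one by uniqueness of the initial value problem
  (\<open>periodic_solution_unique\<close>).

  The solution is smooth, since the functions obtained from powers of \<open>f\<close> and from \<open>f'\<close> by sums and
  products form a class closed under differentiation (\<open>jet_algebra_closed_under_derivative\<close>). The metric
  is invariant under the lattice, whose elements move \<open>s\<close> by multiples of the period. Charts of the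
  quotient are local inverses of the projection, so all coordinate changes are locally translations by
  lattice vectors (\<open>transition_locally_translation\<close>), and these preserve the metric. The quotient is a
  torus by the lattice coordinates modulo \<open>1\<close> (\<open>quotient_plane_lattice_homeomorphic_torus\<close>).
\<close>

section \<open>Oscillation in a potential well\<close>

text \<open>A motion of energy \<open>l\<close> in the well \<open>{x1..x2}\<close> has speed \<open>sqrt (2 (l - P))\<close>, which is not Lipschitz at
the turning points. Dividing out the two zeros of \<open>l - P\<close> removes this: they are simple because
\<open>P'\<close> does not vanish there, so the quotient \<open>q\<close> extends continuously and positively to the ends,
its value at an end being the limit of a difference quotient.\<close>

lemma quotient_of_well_continuous:
  fixes P P' :: "real \<Rightarrow> real"
  assumes lt: "x1 < x2"
    and der: "\<And>x. x \<in> {x1..x2} \<Longrightarrow> (P has_real_derivative P' x) (at x)"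
    and ends: "P x1 = l" "P x2 = l"
    and well: "\<And>x. x \<in> {x1<..<x2} \<Longrightarrow> P x < l"
    and slope: "P' x1 < 0" "0 < P' x2"
  obtains q where "continuous_on {x1..x2} q" "\<And>x. x \<in> {x1..x2} \<Longrightarrow> 0 < q x"
    "\<And>x. x \<in> {x1..x2} \<Longrightarrow> q x * ((x - x1) * (x2 - x)) = l - P x"
proof -
  define q where "q x = (if x = x1 then - P' x1 / (x2 - x1) else if x = x2 then P' x2 / (x2 - x1)
      else (l - P x) / ((x - x1) * (x2 - x)))" for x
  have "isCont q x" if x: "x \<in> {x1..x2}" for x
  proof -
    consider "x = x1" | "x = x2" | "x \<in> {x1<..<x2}" using x by fastforce
    then show ?thesis
    proof cases
      case 1
      have d: "((\<lambda>y. (P y - P x1) / (y - x1)) \<longlongrightarrow> P' x1) (at x1)"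
        using der[of x1] lt by (simp add: has_field_derivative_iff)
      have "((\<lambda>y. - ((P y - P x1) / (y - x1)) / (x2 - y)) \<longlongrightarrow> - P' x1 / (x2 - x1)) (at x1)"
        by (intro tendsto_intros d) (use lt in auto)
      moreover have "\<forall>\<^sub>F y in at x1. - ((P y - P x1) / (y - x1)) / (x2 - y) = q y"
      proof -
        have "\<forall>\<^sub>F y in at x1. y < x2"
          using lt by (intro order_tendstoD(2)[OF tendsto_ident_at])
        moreover have "\<forall>\<^sub>F y in at x1. y \<noteq> x1" by (simp add: eventually_at_filter)
        ultimately show ?thesis
          by eventually_elim (simp add: q_def ends divide_simps)
      qed
      ultimately have "(q \<longlongrightarrow> - P' x1 / (x2 - x1)) (at x1)"
        by (rule Lim_transform_eventually)
      then show ?thesis by (simp add: 1 isCont_def q_def)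
    next
      case 2
      have d: "((\<lambda>y. (P y - P x2) / (y - x2)) \<longlongrightarrow> P' x2) (at x2)"
        using der[of x2] lt by (simp add: has_field_derivative_iff)
      have "((\<lambda>y. ((P y - P x2) / (y - x2)) / (y - x1)) \<longlongrightarrow> P' x2 / (x2 - x1)) (at x2)"
        by (intro tendsto_intros d) (use lt in auto)
      moreover have "\<forall>\<^sub>F y in at x2. ((P y - P x2) / (y - x2)) / (y - x1) = q y"
      proof -
        have "\<forall>\<^sub>F y in at x2. y > x1"
          using lt by (intro order_tendstoD(1)[OF tendsto_ident_at])
        moreover have "\<forall>\<^sub>F y in at x2. y \<noteq> x2" by (simp add: eventually_at_filter)
        ultimately show ?thesis
          by eventually_elim (auto simp: q_def ends divide_simps, (simp add: algebra_simps)+)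
      qed
      ultimately have "(q \<longlongrightarrow> P' x2 / (x2 - x1)) (at x2)"
        by (rule Lim_transform_eventually)
      then show ?thesis using lt by (simp add: 2 isCont_def q_def)
    next
      case 3
      have "isCont P x" using der[OF x] by (rule DERIV_isCont)
      then have c: "isCont (\<lambda>y. (l - P y) / ((y - x1) * (x2 - y))) x"
        using 3 by (intro continuous_intros) auto
      have "\<forall>\<^sub>F y in nhds x. y \<in> {x1<..<x2}"
        using 3 by (intro eventually_nhds_in_open) auto
      then have "\<forall>\<^sub>F y in nhds x. (l - P y) / ((y - x1) * (x2 - y)) = q y"
        by eventually_elim (auto simp: q_def)
      then show ?thesis using isCont_cong c by fastforce
    qed
  qed
  then have "continuous_on {x1..x2} q" by (simp add: continuous_at_imp_continuous_on)
  moreover have "0 < q x" if "x \<in> {x1..x2}" for x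
    using that well[of x] lt slope by (auto simp: q_def divide_simps zero_less_mult_iff)
  moreover have "q x * ((x - x1) * (x2 - x)) = l - P x" if "x \<in> {x1..x2}" for x
    using that ends by (auto simp: q_def)
  ultimately show thesis by (rule that)
qed

text \<open>Writing \<open>x = mid + r sin \<theta>\<close>, with \<open>q\<close> the quotient of the previous lemma, the energy equation
becomes \<open>\<theta>' = sqrt (2 q x)\<close>. Its right-hand side is continuous and positive for all angles and
\<open>2\<pi>\<close>-periodic, so time is obtained as a function \<open>\<tau>\<close> of the angle by one integration, and the
motion by inverting \<open>\<tau>\<close>. Periodicity and the minimal period, the increase of \<open>\<tau>\<close> over one turn, can be
read off.\<close>

lemma well_oscillation:
  fixes P P' :: "real \<Rightarrow> real"
  assumes lt: "x1 < x2"
    and der: "\<And>x. x \<in> {x1..x2} \<Longrightarrow> (P has_real_derivative P' x) (at x)"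
    and cont: "continuous_on {x1..x2} P'"
    and ends: "P x1 = l" "P x2 = l"
    and well: "\<And>x. x \<in> {x1<..<x2} \<Longrightarrow> P x < l"
    and slope: "P' x1 < 0" "0 < P' x2"
  obtains f T where "\<And>s. f s \<in> {x1..x2}"
    "\<And>s. (f has_real_derivative deriv f s) (at s)"
    "\<And>s. (deriv f has_real_derivative - P' (f s)) (at s)"
    "\<And>s. (deriv f s)\<^sup>2 / 2 + P (f s) = l"
    "minimal_period f T"
proof -
  obtain q where q_cont: "continuous_on {x1..x2} q" and q_pos: "\<And>x. x \<in> {x1..x2} \<Longrightarrow> 0 < q x"
    and q_eq: "\<And>x. x \<in> {x1..x2} \<Longrightarrow> q x * ((x - x1) * (x2 - x)) = l - P x"
    using quotient_of_well_continuous[OF lt der ends well slope] by metis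
  define r where "r = (x2 - x1) / 2"
  define X where "X \<theta> = (x1 + x2) / 2 + r * sin \<theta>" for \<theta>
  define w where "w \<theta> = sqrt (2 * q (X \<theta>))" for \<theta>
  have r_pos: "0 < r" using lt by (simp add: r_def)
  have X_in: "X \<theta> \<in> {x1..x2}" for \<theta>
  proof -
    have "\<bar>r * sin \<theta>\<bar> \<le> r" using r_pos by (simp add: abs_mult mult_left_le)
    then show ?thesis by (auto simp: X_def r_def field_simps abs_le_iff)
  qed
  have X_prod: "(X \<theta> - x1) * (x2 - X \<theta>) = (r * cos \<theta>)\<^sup>2" for \<theta>
  proof -
    have "(X \<theta> - x1) * (x2 - X \<theta>) = (r + r * sin \<theta>) * (r - r * sin \<theta>)"
      by (simp add: X_def r_def field_simps)
    also have "\<dots> = r\<^sup>2 * (1 - (sin \<theta>)\<^sup>2)" by (simp add: algebra_simps power2_eq_square)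
    finally show ?thesis by (simp add: power_mult_distrib cos_squared_eq)
  qed
  have w_pos: "0 < w \<theta>" for \<theta> using q_pos[OF X_in] by (simp add: w_def)
  have X_cont: "continuous_on UNIV X" unfolding X_def by (intro continuous_intros)
  have w_cont: "isCont w \<theta>" for \<theta>
  proof -
    have "continuous_on UNIV (\<lambda>\<theta>. q (X \<theta>))"
      using continuous_on_compose2[OF q_cont X_cont] X_in by blast
    then have "continuous_on UNIV w" unfolding w_def by (intro continuous_intros)
    then show ?thesis by (simp add: continuous_on_eq_continuous_at)
  qed
  have X_per: "X (\<theta> + 2 * pi) = X \<theta>" for \<theta> by (simp add: X_def)
  have w_per: "w (\<theta> + 2 * pi) = w \<theta>" for \<theta> by (simp add: w_def X_per)
  \<comment> \<open>The upper bound of the angular speed makes \<open>\<tau>\<close> unbounded in both directions, hence surjective.\<close>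
  obtain B where B: "\<And>\<theta>. w \<theta> \<le> B" "0 < B"
  proof -
    obtain z where "z \<in> {x1..x2}" "\<And>x. x \<in> {x1..x2} \<Longrightarrow> q x \<le> q z"
      using continuous_attains_sup[OF compact_Icc _ q_cont] lt by force
    then show thesis using X_in q_pos by (intro that[of "sqrt (2 * q z)"]) (auto simp: w_def)
  qed
  obtain \<tau> where \<tau>: "\<And>\<theta>. (\<tau> has_real_derivative 1 / w \<theta>) (at \<theta>)"
  proof -
    have "isCont (\<lambda>\<theta>. 1 / w \<theta>) \<theta>" for \<theta>
      using w_cont w_pos[of \<theta>] by (intro continuous_intros) auto
    then obtain \<tau> where "\<forall>\<theta>. -\<infinity> < ereal \<theta> \<longrightarrow> ereal \<theta> < \<infinity> \<longrightarrow> (\<tau> has_vector_derivative 1 / w \<theta>) (at \<theta>)"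
      using einterval_antiderivative[of "-\<infinity>" "\<infinity>" "\<lambda>\<theta>. 1 / w \<theta>"] by auto
    then show thesis by (intro that) (auto simp: has_real_derivative_iff_has_vector_derivative)
  qed
  have \<tau>_mono: "\<tau> u < \<tau> v" if "u < v" for u v
    using that by (rule DERIV_pos_imp_increasing) (meson \<tau> w_pos zero_less_divide_1_iff)
  have \<tau>_cont: "isCont \<tau> \<theta>" for \<theta> using \<tau> by (rule DERIV_isCont)
  have \<tau>_growth: "(v - u) / B \<le> \<tau> v - \<tau> u" if uv: "u < v" for u v
  proof -
    obtain z where "\<tau> v - \<tau> u = (v - u) * (1 / w z)"
      using MVT2[OF uv, of \<tau> "\<lambda>\<theta>. 1 / w \<theta>"] \<tau> by auto
    moreover have "1 / B \<le> 1 / w z" using B w_pos by (simp add: frac_le)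
    then have "(v - u) * (1 / B) \<le> (v - u) * (1 / w z)" using uv by (intro mult_left_mono) auto
    ultimately show ?thesis by simp
  qed
  have \<tau>_surj: "\<exists>\<theta>. \<tau> \<theta> = s" for s
  proof -
    define h where "h = B * \<bar>s - \<tau> 0\<bar> + B"
    have h: "0 < h" "\<bar>s - \<tau> 0\<bar> \<le> h / B" using B(2) by (auto simp: h_def field_simps intro!: add_pos_nonneg mult_nonneg_nonneg)
    have "\<tau> (-h) \<le> s" "s \<le> \<tau> h"
      using \<tau>_growth[of "-h" 0] \<tau>_growth[of 0 h] h by auto
    then show ?thesis using IVT[of \<tau> "-h" s h] h \<tau>_cont by auto
  qed
  define \<theta> where "\<theta> s = (THE u. \<tau> u = s)" for s
  have \<tau>_inj: "u = v" if "\<tau> u = \<tau> v" for u v using \<tau>_mono that by (metis less_irrefl linorder_neqE)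
  have \<theta>\<tau>: "\<theta> (\<tau> u) = u" for u unfolding \<theta>_def using \<tau>_inj by blast
  have \<tau>\<theta>: "\<tau> (\<theta> s) = s" for s using \<tau>_surj \<theta>\<tau> by metis
  have \<theta>_mono: "u < v \<Longrightarrow> \<theta> u < \<theta> v" for u v using \<tau>\<theta> \<tau>_mono by (metis less_asym linorder_neqE less_irrefl)
  have \<theta>_cont: "isCont \<theta> s" for s
    using isCont_inverse_function[of 1 "\<theta> s" \<theta> \<tau>] \<theta>\<tau> \<tau>_cont \<tau>\<theta> by simp
  have \<theta>_der: "(\<theta> has_real_derivative w (\<theta> s)) (at s)" for s
    using DERIV_inverse_function[where f=\<tau> and g=\<theta> and x=s and a="s-1" and b="s+1", OF \<tau>] w_pos[of "\<theta> s"] \<tau>\<theta> \<theta>_cont by auto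
  obtain T where T: "\<And>u. \<tau> (u + 2 * pi) = \<tau> u + T"
  proof -
    have "((\<lambda>u. \<tau> (u + 2 * pi) - \<tau> u) has_real_derivative 0) (at u)" for u
    proof -
      have "((\<lambda>u. \<tau> (u + 2 * pi) - \<tau> u) has_real_derivative 1 / w (u + 2 * pi) * 1 - 1 / w u) (at u)"
        by (intro DERIV_diff DERIV_chain2[OF \<tau>] \<tau>) (auto intro!: derivative_eq_intros)
      then show ?thesis by (simp add: w_per)
    qed
    then have "\<tau> (u + 2 * pi) - \<tau> u = \<tau> (0 + 2 * pi) - \<tau> 0" for u
      using DERIV_isconst_all[of "\<lambda>u. \<tau> (u + 2 * pi) - \<tau> u"] by blast
    then show thesis by (intro that[of "\<tau> (2 * pi) - \<tau> 0"]) (simp add: algebra_simps)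
  qed
  have T_pos: "0 < T" using T[of 0] \<tau>_mono[of 0 "0 + 2 * pi"] pi_gt_zero by linarith
  have \<theta>_shift: "\<theta> (s + T) = \<theta> s + 2 * pi" for s using T[of "\<theta> s"] \<tau>\<theta> \<theta>\<tau> by metis
  define f where "f s = X (\<theta> s)" for s
  define v where "v s = r * cos (\<theta> s) * w (\<theta> s)" for s
  have f_in: "f s \<in> {x1..x2}" for s using X_in by (simp add: f_def)
  have f_der: "(f has_real_derivative v s) (at s)" for s
    unfolding f_def v_def X_def by (auto intro!: derivative_eq_intros \<theta>_der)
  have v_deriv: "deriv f = v" using f_der DERIV_imp_deriv by blast
  have energy: "(v s)\<^sup>2 = 2 * (l - P (f s))" for s
  proof -
    have "(v s)\<^sup>2 = (r * cos (\<theta> s))\<^sup>2 * (2 * q (f s))"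
      using q_pos[OF f_in[of s]] by (simp add: v_def w_def f_def power_mult_distrib)
    also have "(r * cos (\<theta> s))\<^sup>2 = (f s - x1) * (x2 - f s)" by (simp add: f_def X_prod)
    also have "\<dots> * (2 * q (f s)) = 2 * (l - P (f s))" 
      unfolding q_eq[OF f_in, symmetric] by simp
    finally show ?thesis .
  qed
  have v_cont: "isCont v s" for s
    unfolding v_def
    by (intro isCont_mult continuous_const isCont_o2[OF _ isCont_cos] \<theta>_cont
        isCont_o2[OF \<theta>_cont w_cont])
  have abs_v: "sqrt (2 * (l - P (f s))) = \<bar>v s\<bar>" for s
    using energy[of s] by (metis real_sqrt_abs)
  have P_f: "((\<lambda>s. P (f s)) has_real_derivative P' (f s) * v s) (at s)" for s
    using DERIV_chain2[OF der f_der] f_in by blast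
  \<comment> \<open>Where the velocity keeps its sign, it is a signed square root of a differentiable function.\<close>
  have v_der_nz: "(v has_real_derivative - P' (f s)) (at s)" if nz: "v s \<noteq> 0" for s
  proof -
    define \<epsilon> where "\<epsilon> = sgn (v s)"
    have "\<forall>\<^sub>F y in nhds s. 0 < \<epsilon> * v y"
    proof (rule order_tendstoD(1))
      show "((\<lambda>y. \<epsilon> * v y) \<longlongrightarrow> \<epsilon> * v s) (nhds s)"
        using v_cont[of s] by (intro tendsto_intros) (simp add: continuous_at_imp_continuous_at_within tendsto_nhds_iff isCont_def)
      show "0 < \<epsilon> * v s" using nz by (simp add: \<epsilon>_def sgn_if)
    qed
    then have ev: "\<forall>\<^sub>F y in nhds s. \<epsilon> * sqrt (2 * (l - P (f y))) = v y"
    proof eventually_elim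
      case (elim y)
      then show ?case unfolding abs_v using nz by (auto simp: \<epsilon>_def sgn_if split: if_splits)
    qed
    have pos: "0 < 2 * (l - P (f s))" using energy[of s] nz by (metis zero_less_power2)
    have sq: "sqrt (2 * (l - P (f s))) = \<epsilon> * v s"
      unfolding abs_v by (simp add: \<epsilon>_def abs_sgn)
    have "((\<lambda>y. \<epsilon> * sqrt (2 * (l - P (f y)))) has_real_derivative - P' (f s)) (at s)"
    proof -
      have "((\<lambda>y. 2 * (l - P (f y))) has_real_derivative - 2 * (P' (f s) * v s)) (at s)"
        by (auto intro!: derivative_eq_intros P_f)
      then have "((\<lambda>y. \<epsilon> * sqrt (2 * (l - P (f y)))) has_real_derivative
          \<epsilon> * (inverse (\<epsilon> * v s) / 2 * (- 2 * (P' (f s) * v s)))) (at s)"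
        using DERIV_cmult[OF DERIV_chain2[where f = sqrt and g = "\<lambda>y. 2 * (l - P (f y))", OF DERIV_real_sqrt[OF pos]]]
        unfolding sq by blast
      moreover have "\<epsilon> * (inverse (\<epsilon> * v s) / 2 * (- 2 * (P' (f s) * v s))) = - P' (f s)"
        using nz by (simp add: \<epsilon>_def sgn_if)
      ultimately show ?thesis by (rule DERIV_cong)
    qed
    then show ?thesis using DERIV_cong_ev[OF refl ev refl] by blast
  qed
  \<comment> \<open>At a turning point the energy equation cannot be differentiated; the derivative of \<open>v\<close>
    there is the limit of its derivatives at the neighbouring times.\<close>
  have v_der: "(v has_real_derivative - P' (f s)) (at s)" for s
  proof (cases "v s = 0")
    case False
    then show ?thesis by (rule v_der_nz)
  next
    case True
    then have cos0: "cos (\<theta> s) = 0" using r_pos w_pos[of "\<theta> s"] by (simp add: v_def)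
    have "((\<lambda>y. cos (\<theta> y)) has_real_derivative - sin (\<theta> s) * w (\<theta> s)) (at s)"
      by (auto intro!: derivative_eq_intros \<theta>_der)
    then have "((\<lambda>y. (cos (\<theta> y) - cos (\<theta> s)) / (y - s)) \<longlongrightarrow> - sin (\<theta> s) * w (\<theta> s)) (at s)"
      by (simp add: has_field_derivative_iff)
    moreover have "- sin (\<theta> s) * w (\<theta> s) \<noteq> 0"
      using cos0 w_pos[of "\<theta> s"] sin_cos_squared_add[of "\<theta> s"] by auto
    ultimately have "\<forall>\<^sub>F y in at s. (cos (\<theta> y) - cos (\<theta> s)) / (y - s) \<noteq> 0"
      by (rule tendsto_imp_eventually_ne)
    then have nz: "\<forall>\<^sub>F y in at s. v y \<noteq> 0"
      by eventually_elim (use cos0 r_pos w_pos in \<open>auto simp: v_def less_imp_neq[symmetric]\<close>)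
    have f_cont: "isCont f s" using f_der by (rule DERIV_isCont)
    have "continuous_on UNIV (\<lambda>y. P' (f y))"
      by (rule continuous_on_compose2[OF cont])
        (use f_in DERIV_isCont[OF f_der] in \<open>auto intro!: continuous_at_imp_continuous_on\<close>)
    then have lim: "((\<lambda>y. - P' (f y)) \<longlongrightarrow> - P' (f s)) (at s)"
      by (intro tendsto_minus) (simp add: continuous_on_eq_continuous_at isCont_def)
    have "((\<lambda>y. (v y - v s) / (y - s)) \<longlongrightarrow> - P' (f s)) (at s)"
    proof (rule lhopital[where f' = "\<lambda>y. - P' (f y)" and g' = "\<lambda>_. 1"])
      show "((\<lambda>y. v y - v s) \<longlongrightarrow> 0) (at s)"
        using v_cont[of s] by (simp add: isCont_def LIM_zero_iff)
      show "((\<lambda>y. y - s) \<longlongrightarrow> 0) (at s)" by (simp add: LIM_zero_iff)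
      show "\<forall>\<^sub>F y in at s. y - s \<noteq> 0" by (simp add: eventually_at_filter)
      show "\<forall>\<^sub>F y in at s. ((\<lambda>y. v y - v s) has_real_derivative - P' (f y)) (at y)"
        using nz by eventually_elim (auto intro!: derivative_eq_intros v_der_nz)
      show "\<forall>\<^sub>F y in at s. ((\<lambda>y. y - s) has_real_derivative 1) (at y)"
        by (intro always_eventually allI) (auto intro!: derivative_eq_intros)
    qed (use lim in auto)
    then show ?thesis by (simp add: has_field_derivative_iff)
  qed
  have "minimal_period f T"
    unfolding minimal_period_def
  proof (intro conjI allI impI)
    show "0 < T" by (fact T_pos)
    show "f (s + T) = f s" for s by (simp add: f_def \<theta>_shift X_per)
    fix T' assume T': "0 < T' \<and> T' < T"
    \<comment> \<open>The maximum of \<open>f\<close> is attained exactly at the angles \<open>\<pi>/2 + 2\<pi>k\<close>.\<close>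
    define s where "s = \<tau> (pi / 2)"
    define u where "u = \<theta> (s + T') - pi / 2"
    have "\<theta> s < \<theta> (s + T')" "\<theta> (s + T') < \<theta> (s + T)" using T' by (auto intro: \<theta>_mono)
    then have u: "0 < u" "u < 2 * pi" by (auto simp: u_def s_def \<theta>\<tau> \<theta>_shift)
    have "f (s + T') \<noteq> f s"
    proof
      assume "f (s + T') = f s"
      then have "sin (u + pi / 2) = 1" using r_pos by (simp add: f_def X_def s_def \<theta>\<tau> u_def)
      then have "cos u = 1" by (simp add: sin_add)
      then obtain k :: int where "u = k * 2 * pi" by (auto simp: cos_one_2pi_int)
      then have "0 < k * (2 * pi)" "k * (2 * pi) < 1 * (2 * pi)" using u by auto
      then have "0 < real_of_int k" "real_of_int k < real_of_int 1"
        using zero_less_mult_pos2[of "real_of_int k" "2 * pi"] mult_less_cancel_right_pos[of "2 * pi" "real_of_int k" 1]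
        by auto
      then have "0 < k" "k < 1" by (simp_all only: of_int_less_iff of_int_0_less_iff)
      then show False by simp
    qed
    then show "\<exists>s. f (s + T') \<noteq> f s" by blast
  qed
  moreover have "(deriv f s)\<^sup>2 / 2 + P (f s) = l" for s
    using energy[of s] by (simp add: v_deriv field_simps)
  ultimately show thesis
    using that[of f T] f_in f_der v_der by (simp add: v_deriv)
qed

section \<open>Uniqueness for Newton's equation\<close>

text \<open>The bound makes \<open>D t * exp (- K t)\<close> nonincreasing and \<open>D t * exp (K t)\<close> nondecreasing, which
controls \<open>D\<close> for positive and negative times respectively.\<close>

lemma gronwall_zero:
  fixes D :: "real \<Rightarrow> real"
  assumes der: "\<And>t. (D has_real_derivative D' t) (at t)"
    and bound: "\<And>t. \<bar>D' t\<bar> \<le> K * D t"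
    and nonneg: "\<And>t. 0 \<le> D t" and "D 0 = 0"
  shows "D t = 0"
proof -
  have up: "D t * exp (- K * t) \<le> D 0 * exp (- K * 0)" if "0 \<le> t"
  proof (rule DERIV_nonpos_imp_nonincreasing[OF that])
    fix x
    have "((\<lambda>t. D t * exp (- K * t)) has_real_derivative (D' x - K * D x) * exp (- K * x)) (at x)"
      by (auto intro!: derivative_eq_intros der simp: algebra_simps)
    moreover have "(D' x - K * D x) * exp (- K * x) \<le> 0"
      using bound[of x] by (intro mult_nonpos_nonneg) auto
    ultimately show "\<exists>y. ((\<lambda>t. D t * exp (- K * t)) has_real_derivative y) (at x) \<and> y \<le> 0"
      by blast
  qed
  have down: "D t * exp (K * t) \<le> D 0 * exp (K * 0)" if "t \<le> 0"
  proof (rule DERIV_nonneg_imp_nondecreasing[OF that])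
    fix x
    have "((\<lambda>t. D t * exp (K * t)) has_real_derivative (D' x + K * D x) * exp (K * x)) (at x)"
      by (auto intro!: derivative_eq_intros der simp: algebra_simps)
    moreover have "0 \<le> (D' x + K * D x) * exp (K * x)"
      using bound[of x] by (intro mult_nonneg_nonneg) auto
    ultimately show "\<exists>y. ((\<lambda>t. D t * exp (K * t)) has_real_derivative y) (at x) \<and> 0 \<le> y"
      by blast
  qed
  have "D t \<le> 0"
  proof (cases "0 \<le> t")
    case True
    then show ?thesis using up \<open>D 0 = 0\<close> by (simp add: mult_le_0_iff)
  next
    case False
    then show ?thesis using down \<open>D 0 = 0\<close> by (simp add: mult_le_0_iff)
  qed
  then show ?thesis using nonneg[of t] by simp
qed

text \<open>The squared distance of the two motions in phase space satisfies the hypotheses of the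
previous lemma. The Lipschitz bound is needed only along the two motions, so it can be
taken on the compact well.\<close>

lemma newton_equation_unique:
  fixes f g f' g' F :: "real \<Rightarrow> real"
  assumes f: "\<And>s. (f has_real_derivative f' s) (at s)" "\<And>s. (f' has_real_derivative F (f s)) (at s)"
    and g: "\<And>s. (g has_real_derivative g' s) (at s)" "\<And>s. (g' has_real_derivative F (g s)) (at s)"
    and lip: "\<And>s. \<bar>F (f s) - F (g s)\<bar> \<le> L * \<bar>f s - g s\<bar>"
    and init: "f 0 = g 0" "f' 0 = g' 0"
  shows "f s = g s"
proof -
  define D where "D s = (f s - g s)\<^sup>2 + (f' s - g' s)\<^sup>2" for s
  define D' where "D' s = 2 * (f s - g s) * (f' s - g' s) + 2 * (f' s - g' s) * (F (f s) - F (g s))" for s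
  have "D s = 0"
  proof (rule gronwall_zero[where D = D and D' = D' and t = s and K = "1 + \<bar>L\<bar>"])
    show "(D has_real_derivative D' s) (at s)" for s
      unfolding D_def D'_def by (auto intro!: derivative_eq_intros f g simp: algebra_simps)
    show "\<bar>D' s\<bar> \<le> (1 + \<bar>L\<bar>) * D s" for s
    proof -
      define d e h where "d = \<bar>f s - g s\<bar>" and "e = \<bar>f' s - g' s\<bar>" and "h = \<bar>F (f s) - F (g s)\<bar>"
      have "L * d \<le> \<bar>L\<bar> * d" by (intro mult_right_mono) (auto simp: d_def)
      then have h: "h \<le> \<bar>L\<bar> * d" using lip[of s] by (simp add: h_def d_def)
      have "\<bar>D' s\<bar> \<le> 2 * d * e + 2 * e * h"
      proof -
        have "\<bar>D' s\<bar> \<le> \<bar>2 * (f s - g s) * (f' s - g' s)\<bar> + \<bar>2 * (f' s - g' s) * (F (f s) - F (g s))\<bar>"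
          unfolding D'_def by (rule abs_triangle_ineq)
        also have "\<dots> = 2 * d * e + 2 * e * h"
          unfolding d_def e_def h_def abs_mult by simp
        finally show ?thesis .
      qed
      also have "\<dots> \<le> 2 * d * e + 2 * e * (\<bar>L\<bar> * d)"
        using h by (intro add_left_mono mult_left_mono) (auto simp: e_def)
      also have "\<dots> = (1 + \<bar>L\<bar>) * (2 * d * e)" by (simp add: algebra_simps)
      also have "\<dots> \<le> (1 + \<bar>L\<bar>) * (d\<^sup>2 + e\<^sup>2)"
        by (intro mult_left_mono sum_squares_bound) auto
      finally show ?thesis by (simp add: D_def d_def e_def)
    qed
  qed (use init in \<open>auto simp: D_def\<close>)
  then show ?thesis by (simp add: D_def sum_power2_eq_zero_iff)
qed

section \<open>The potential and its periodic solutions\<close>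

definition potential_slope :: "real \<Rightarrow> real \<Rightarrow> real \<Rightarrow> real \<Rightarrow> real" where
  "potential_slope a c m x = c * x - m * x powr (1 - a)"

lemma potential_derivative:
  assumes "0 < x"
  shows "(potential a c m has_real_derivative potential_slope a c m x) (at x)"
proof (cases "a = 2")
  case True
  have "((\<lambda>x. - m * ln x + c * x\<^sup>2 / 2) has_real_derivative - m * (1 / x) + c * x) (at x)"
    using assms by (auto intro!: derivative_eq_intros)
  then show ?thesis
    using assms True by (simp add: potential_def[abs_def] potential_slope_def powr_minus_divide)
next
  case False
  have "((\<lambda>x. x powr (2 - a)) has_real_derivative (2 - a) * x powr (1 - a)) (at x)"
    using has_real_derivative_powr[OF assms, of "2 - a"] by simp
  then have "((\<lambda>x. - m / (2 - a) * x powr (2 - a) + c / 2 * x\<^sup>2) has_real_derivative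
      - m / (2 - a) * ((2 - a) * x powr (1 - a)) + c / 2 * (2 * x)) (at x)"
    by (intro DERIV_add DERIV_cmult) (auto intro!: derivative_eq_intros)
  then show ?thesis
    using False by (simp add: potential_def[abs_def] potential_slope_def)
qed

text \<open>The slope is \<open>x * k x\<close> with \<open>k x = c - m * x powr (- a)\<close>, and \<open>k\<close> is strictly increasing because
\<open>a * m > 0\<close>: the numbers \<open>a\<close>, \<open>c\<close> and \<open>m\<close> have the same sign. Hence \<open>k\<close> changes sign once, at
\<open>x0 = (m / c) powr (1 / a)\<close>, and the potential strictly decreases up to \<open>x0\<close> and strictly
increases afterwards. The energy lies above the minimum, below the limit at \<open>0\<close>, and below some
value to the right of \<open>x0\<close> since the slope is positive and increasing there. The turning
points then come from the intermediate value theorem on either side of \<open>x0\<close>.\<close>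

lemma admissible_well:
  assumes ac: "0 < a * c" and adm: "admissible a c m l"
  obtains x1 x2 where "0 < x1" "x1 < x2" "potential a c m x1 = l" "potential a c m x2 = l"
    "\<And>x. x \<in> {x1<..<x2} \<Longrightarrow> potential a c m x < l"
    "\<And>x. 0 < x \<Longrightarrow> x \<notin> {x1..x2} \<Longrightarrow> l < potential a c m x"
    "potential_slope a c m x1 < 0" "0 < potential_slope a c m x2"
proof -
  let ?P = "potential a c m" and ?P' = "potential_slope a c m"
  have cm: "0 < c * m" and least: "(LEAST v. v \<in> ?P ` {0<..}) < l"
    and lim: "ereal l < Lim (at_right 0) (\<lambda>x. ereal (?P x))"
    using adm by (auto simp: admissible_def)
  define k where "k x = c - m * x powr (- a)" for x
  have slope: "?P' x = x * k x" if "0 < x" for x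
    using that powr_add[of x 1 "- a"] by (simp add: potential_slope_def k_def algebra_simps)
  have k_mono: "k x < k y" if "0 < x" "x < y" for x y
  proof (cases "0 < a")
    case True
    then have "0 < m" using ac cm by (auto simp: zero_less_mult_iff)
    then show ?thesis using that True powr_less_mono2_neg[of "- a" x y] by (simp add: k_def)
  next
    case False
    then have "a < 0" "m < 0" using ac cm by (auto simp: zero_less_mult_iff)
    then show ?thesis using that powr_less_mono2[of "- a" x y] by (simp add: k_def)
  qed
  define x0 where "x0 = (m / c) powr (1 / a)"
  have a: "a \<noteq> 0" and mc: "0 < m / c" using ac cm by (auto simp: zero_less_mult_iff zero_less_divide_iff)
  then have "x0 powr (- a) = (m / c) powr (- 1)"
    unfolding x0_def powr_powr by (intro arg_cong2[of _ _ _ _ "(powr)"]) auto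
  also have "\<dots> = c / m" unfolding powr_minus powr_one[OF less_imp_le[OF mc]] by simp
  finally have x0: "0 < x0" "k x0 = 0"
    using mc cm by (auto simp: x0_def k_def)
  have neg: "?P' x < 0" if "0 < x" "x < x0" for x
    using k_mono[OF that] that x0 by (simp add: slope mult_pos_neg)
  have pos: "0 < ?P' x" if "x0 < x" for x
    using k_mono[OF x0(1) that] that x0 by (simp add: slope)
  have dec: "?P y < ?P x" if "0 < x" "x < y" "y \<le> x0" for x y
  proof (rule DERIV_neg_imp_decreasing_open[OF \<open>x < y\<close>])
    show "\<exists>d. (?P has_real_derivative d) (at z) \<and> d < 0" if "x < z" "z < y" for z
      using that \<open>0 < x\<close> \<open>y \<le> x0\<close> by (intro exI[of _ "?P' z"] conjI potential_derivative neg) auto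
    show "continuous_on {x..y} ?P"
      using \<open>0 < x\<close> by (intro continuous_at_imp_continuous_on ballI DERIV_isCont[OF potential_derivative]) auto
  qed
  have inc: "?P x < ?P y" if "x0 \<le> x" "x < y" for x y
  proof (rule DERIV_pos_imp_increasing_open[OF \<open>x < y\<close>])
    show "\<exists>d. (?P has_real_derivative d) (at z) \<and> d > 0" if "x < z" "z < y" for z
      using that \<open>x0 \<le> x\<close> x0 by (intro exI[of _ "?P' z"] conjI potential_derivative pos) auto
    show "continuous_on {x..y} ?P"
      using \<open>x0 \<le> x\<close> x0 by (intro continuous_at_imp_continuous_on ballI DERIV_isCont[OF potential_derivative]) auto
  qed
  have cont: "isCont ?P x" if "0 < x" for x by (rule DERIV_isCont[OF potential_derivative[OF that]])
  have "?P x0 \<le> ?P x" if "0 < x" for x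
    using dec[of x x0] inc[of x0 x] that by (cases x x0 rule: linorder_cases) auto
  then have "(LEAST v. v \<in> ?P ` {0<..}) = ?P x0"
    using x0 by (intro Least_equality) auto
  then have min: "?P x0 < l" using least by simp
  \<comment> \<open>By monotonicity the limit at \<open>0\<close> exists and is a supremum, so some value exceeds \<open>l\<close>.\<close>
  obtain u where u: "0 < u" "u < x0" "l < ?P u"
  proof -
    define S where "S = (SUP x\<in>{0<..<x0}. ereal (?P x))"
    have "((\<lambda>x. ereal (?P x)) \<longlongrightarrow> S) (at_right 0)"
    proof (rule order_tendstoI)
      fix y assume "y < S"
      then obtain x where x: "0 < x" "x < x0" "y < ereal (?P x)" by (auto simp: S_def less_SUP_iff)
      have "\<forall>\<^sub>F z in at_right 0. 0 < z \<and> z < x"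
        using x(1) by (auto simp: eventually_at_right_field)
      then show "\<forall>\<^sub>F z in at_right 0. y < ereal (?P z)"
      proof eventually_elim
        case (elim z)
        then have "?P x < ?P z" using dec x by auto
        then show ?case using less_trans[OF x(3), of "ereal (?P z)"] by simp
      qed
    next
      fix y assume "S < y"
      have "\<forall>\<^sub>F z in at_right 0. 0 < z \<and> z < x0"
        using x0 by (auto simp: eventually_at_right_field)
      then show "\<forall>\<^sub>F z in at_right 0. ereal (?P z) < y"
      proof eventually_elim
        case (elim z)
        then have "ereal (?P z) \<le> S" unfolding S_def by (intro SUP_upper) auto
        then show ?case using \<open>S < y\<close> by (rule le_less_trans)
      qed
    qed
    then have "Lim (at_right 0) (\<lambda>x. ereal (?P x)) = S" by (intro tendsto_Lim) auto
    then have "ereal l < S" using lim by simp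
    then show thesis using that by (auto simp: S_def less_SUP_iff)
  qed
  obtain v where v: "x0 < v" "l < ?P v"
  proof -
    \<comment> \<open>Any point beyond \<open>x0\<close> would do for \<open>b\<close>.\<close>
    define b where "b = 2 * x0"
    have b: "x0 < b" "0 < ?P' b" using x0 pos by (auto simp: b_def)
    define y where "y = b + (\<bar>l - ?P b\<bar> + 1) / ?P' b"
    have bY: "b < y" using b by (simp add: y_def add_nonneg_pos)
    obtain z where z: "b < z" "z < y" "?P y - ?P b = (y - b) * ?P' z"
    proof -
      have "(?P has_real_derivative ?P' x) (at x)" if "b \<le> x" "x \<le> y" for x
        using that b x0 by (intro potential_derivative) auto
      then show thesis using MVT2[OF bY, of ?P ?P'] that by blast
    qed
    have "?P' b \<le> ?P' z"
      using b z x0 k_mono[of b z] k_mono[of x0 b] by (simp add: slope mult_mono)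
    then have "(y - b) * ?P' b \<le> ?P y - ?P b" unfolding z using bY by (intro mult_left_mono) auto
    moreover have "(y - b) * ?P' b = \<bar>l - ?P b\<bar> + 1" using b by (simp add: y_def)
    ultimately have "l < ?P y" by linarith
    moreover have "x0 < y" using b bY by simp
    ultimately show thesis using that by blast
  qed
  obtain x1 where x1: "u \<le> x1" "x1 \<le> x0" "?P x1 = l"
    using IVT2[of ?P x0 l u] u min cont by (auto simp: less_imp_le)
  obtain x2 where x2: "x0 \<le> x2" "x2 \<le> v" "?P x2 = l"
    using IVT[of ?P x0 l v] v x0 min cont by (auto simp: less_imp_le)
  have ne: "x1 < x0" "x0 < x2" using min x1 x2 by (auto simp: less_le)
  show thesis
  proof (rule that[of x1 x2])
    show "?P x < l" if "x \<in> {x1<..<x2}" for x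
      using dec[of x1 x] inc[of x x2] that x1 x2 u by (cases "x \<le> x0") auto
    show "l < ?P x" if "0 < x" "x \<notin> {x1..x2}" for x
      using dec[of x x1] inc[of x2 x] that x1 x2 u by auto
  qed (use neg pos x1 x2 ne u in auto)
qed

lemma periodic_solution_exists:
  assumes "0 < a * c" and "admissible a c m l"
  shows "\<exists>f T. periodic_solution a c m l f T"
proof -
  obtain x1 x2 where x: "0 < x1" "x1 < x2" "potential a c m x1 = l" "potential a c m x2 = l"
    "\<And>x. x \<in> {x1<..<x2} \<Longrightarrow> potential a c m x < l"
    "potential_slope a c m x1 < 0" "0 < potential_slope a c m x2"
    using admissible_well[OF assms] by metis
  have cont: "continuous_on {x1..x2} (potential_slope a c m)"
    unfolding potential_slope_def[abs_def] using x(1) by (intro continuous_intros) auto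
  have der: "(potential a c m has_real_derivative potential_slope a c m x) (at x)" if "x \<in> {x1..x2}" for x
    using that x(1) by (intro potential_derivative) auto
  obtain f T where f: "\<And>s. f s \<in> {x1..x2}"
    "\<And>s. (f has_real_derivative deriv f s) (at s)"
    "\<And>s. (deriv f has_real_derivative - potential_slope a c m (f s)) (at s)"
    "\<And>s. (deriv f s)\<^sup>2 / 2 + potential a c m (f s) = l"
    "minimal_period f T"
    using well_oscillation[OF x(2) der cont x(3-7)] by metis
  have "0 < f s" for s using f(1)[of s] x(1) by auto
  then have "periodic_solution a c m l f T"
    using f unfolding periodic_solution_def by (simp add: potential_slope_def)
  then show ?thesis by blast
qed

lemma periodic_continuous_attains_max:
  fixes f :: "real \<Rightarrow> real"
  assumes T: "0 < T" "\<And>s. f (s + T) = f s" and cont: "continuous_on UNIV f"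
  obtains s1 where "\<And>s. f s \<le> f s1"
proof -
  interpret periodic_fun_simple f T by unfold_locales (rule T)
  obtain s1 where s1: "\<And>s. s \<in> {0..T} \<Longrightarrow> f s \<le> f s1"
  proof -
    have "{0..T} \<noteq> {}" using T(1) by simp
    then show thesis
      using continuous_attains_sup[OF compact_Icc _ continuous_on_subset[OF cont subset_UNIV]] that by blast
  qed
  have "f s \<le> f s1" for s
  proof -
    define n where "n = \<lfloor>s / T\<rfloor>"
    define u where "u = s - of_int n * T"
    have "of_int n \<le> s / T" "s / T \<le> of_int n + 1" unfolding n_def by linarith+
    then have "of_int n * T \<le> s" "s \<le> of_int n * T + T"
      using T(1) by (simp_all add: pos_le_divide_eq pos_divide_le_eq distrib_right)
    then have "u \<in> {0..T}" by (simp add: u_def)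
    then have "f u \<le> f s1" by (rule s1)
    then show ?thesis by (simp add: u_def minus_of_int)
  qed
  then show thesis by (rule that)
qed

text \<open>A periodic solution attains its maximum, where the velocity vanishes, so the maximum is a
turning value. It is not the lower one: the solution would then be constant at a point where the
force does not vanish. Hence both solutions pass through the upper turning point with velocity
zero, and after shifting these times to \<open>0\<close> they agree by uniqueness for Newton's equation.\<close>

lemma periodic_solution_unique:
  assumes ac: "0 < a * c" and adm: "admissible a c m l"
    and sol: "periodic_solution a c m l f1 T1" "periodic_solution a c m l f2 T2"
  shows "T1 = T2 \<and> (\<exists>s0. \<forall>s. f2 s = f1 (s + s0))"
proof -
  obtain x1 x2 where x: "0 < x1" "x1 < x2" "potential a c m x1 = l" "potential a c m x2 = l"
    "\<And>x. x \<in> {x1<..<x2} \<Longrightarrow> potential a c m x < l"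
    "\<And>x. 0 < x \<Longrightarrow> x \<notin> {x1..x2} \<Longrightarrow> l < potential a c m x"
    "potential_slope a c m x1 < 0" "0 < potential_slope a c m x2"
    using admissible_well[OF ac adm] by metis
  define F where "F x = m * x powr (1 - a) - c * x" for x
  have range: "f s \<in> {x1..x2}" if "periodic_solution a c m l f T" for f T s
  proof (rule ccontr)
    assume "f s \<notin> {x1..x2}"
    moreover have "0 < f s" "(deriv f s)\<^sup>2 / 2 + potential a c m (f s) = l"
      using that by (auto simp: periodic_solution_def)
    moreover have "0 \<le> (deriv f s)\<^sup>2 / 2" by simp
    ultimately show False using x(6)[of "f s"] by linarith
  qed
  have top: "\<exists>s. f s = x2 \<and> deriv f s = 0" if f: "periodic_solution a c m l f T" for f T
  proof -
    have der: "(f has_real_derivative deriv f s) (at s)"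
      and der2: "(deriv f has_real_derivative - potential_slope a c m (f s)) (at s)"
      and energy: "(deriv f s)\<^sup>2 / 2 + potential a c m (f s) = l"
      and T: "0 < T" "f (s + T) = f s" for s
      using f by (auto simp: periodic_solution_def minimal_period_def potential_slope_def)
    have "continuous_on UNIV f" by (intro continuous_at_imp_continuous_on ballI DERIV_isCont[OF der])
    then obtain s where s: "\<And>u. f u \<le> f s"
      using periodic_continuous_attains_max[where f = f, OF T] by metis
    have d0: "deriv f s = 0" using DERIV_local_max[OF der, of 1] s by simp
    then have "potential a c m (f s) = l" using energy[of s] by simp
    then have "f s = x1 \<or> f s = x2" using x(5)[of "f s"] range[OF f, of s] by fastforce
    moreover have "f s \<noteq> x1"
    proof
      assume "f s = x1"
      then have "f = (\<lambda>_. x1)" using s range[OF f] by (auto intro!: ext antisym)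
      then show False using der2[of s] x(7) DERIV_unique[OF der2[of s], of 0] by simp
    qed
    ultimately show ?thesis using d0 by blast
  qed
  obtain s1 s2 where s: "f1 s1 = x2" "deriv f1 s1 = 0" "f2 s2 = x2" "deriv f2 s2 = 0"
    using top[OF sol(1)] top[OF sol(2)] by blast
  have "\<exists>L. \<forall>u\<in>{x1..x2}. \<forall>v\<in>{x1..x2}. \<bar>F u - F v\<bar> \<le> L * \<bar>u - v\<bar>"
  proof -
    define F' where "F' x = m * ((1 - a) * x powr (- a)) - c" for x
    have "continuous_on {x1..x2} F'"
      unfolding F'_def using x(1) by (intro continuous_intros) auto
    then have "bounded (F' ` {x1..x2})" by (intro compact_imp_bounded compact_continuous_image) auto
    then obtain L where L: "\<And>u. u \<in> {x1..x2} \<Longrightarrow> norm (F' u) \<le> L"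
      unfolding bounded_iff by blast
    have "(F has_real_derivative F' u) (at u)" if "u \<in> {x1..x2}" for u
    proof -
      have "((\<lambda>x. x powr (1 - a)) has_real_derivative (1 - a) * u powr (- a)) (at u)"
      proof -
        have "0 < u" using that x(1) by simp
        then show ?thesis using has_real_derivative_powr[of u "1 - a"] by simp
      qed
      then show ?thesis unfolding F_def F'_def by (intro DERIV_diff DERIV_cmult DERIV_cmult_Id)
    qed
    then have "norm (F u - F v) \<le> L * norm (u - v)" if "u \<in> {x1..x2}" "v \<in> {x1..x2}" for u v
      using that L
      by (intro field_differentiable_bound[of "{x1..x2}" F F']) (auto intro: DERIV_subset)
    then show ?thesis by (auto intro!: exI[of _ L])
  qed
  then obtain L where L: "\<And>u v. u \<in> {x1..x2} \<Longrightarrow> v \<in> {x1..x2} \<Longrightarrow> \<bar>F u - F v\<bar> \<le> L * \<bar>u - v\<bar>"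
    by blast
  have "f2 (s + s2) = f1 (s + s1)" for s
  proof (rule newton_equation_unique[where f = "\<lambda>s. f2 (s + s2)" and g = "\<lambda>s. f1 (s + s1)"
        and s = s and f' = "\<lambda>s. deriv f2 (s + s2)" and g' = "\<lambda>s. deriv f1 (s + s1)" and F = F and L = L])
    show "\<bar>F (f2 (s + s2)) - F (f1 (s + s1))\<bar> \<le> L * \<bar>f2 (s + s2) - f1 (s + s1)\<bar>" for s
      by (intro L range[OF sol(1)] range[OF sol(2)])
  qed (use sol s in \<open>auto simp: periodic_solution_def F_def intro!: DERIV_shift[THEN iffD1]\<close>)
  from this[of "s - s2" for s] have shift: "f2 s = f1 (s + (s1 - s2))" for s
    by (simp add: algebra_simps)
  have "minimal_period f1 T1" "minimal_period f2 T2"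
    using sol by (auto simp: periodic_solution_def)
  moreover have "(\<forall>s. f2 (s + T) = f2 s) \<longleftrightarrow> (\<forall>s. f1 (s + T) = f1 s)" for T
  proof
    assume "\<forall>s. f1 (s + T) = f1 s"
    then have "f1 (s + (s1 - s2) + T) = f1 (s + (s1 - s2))" for s by blast
    then show "\<forall>s. f2 (s + T) = f2 s" by (simp add: shift ac_simps)
  next
    assume "\<forall>s. f2 (s + T) = f2 s"
    then have "f2 (s - (s1 - s2) + T) = f2 (s - (s1 - s2))" for s by blast
    then show "\<forall>s. f1 (s + T) = f1 s" by (simp add: shift algebra_simps)
  qed
  ultimately have "T1 = T2"
    unfolding minimal_period_def by (meson linorder_less_linear)
  then show ?thesis using shift by blast
qed

section \<open>Curvature of warped metrics\<close>

lemma has_derivative_fst_coord: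
  fixes \<phi> :: "real \<Rightarrow> real" and x :: "real^2"
  assumes "(\<phi> has_real_derivative d) (at (x $ 1))"
  shows "((\<lambda>y :: real^2. \<phi> (y $ 1)) has_derivative (\<lambda>h. h $ 1 * d)) (at x)"
proof -
  have "((\<lambda>y :: real^2. y $ 1) has_derivative (\<lambda>h. h $ 1)) (at x)"
    by (rule bounded_linear_imp_has_derivative[OF bounded_linear_vec_nth])
  then show ?thesis
    using DERIV_compose_FDERIV[where g = "\<lambda>y :: real^2. y $ 1", OF assms] by simp
qed

lemma partial_of_fst_coord:
  assumes "(\<phi> has_real_derivative d) (at (x $ 1))"
  shows "partial 1 (\<lambda>y. \<phi> (y $ 1)) x = d" "partial 2 (\<lambda>y. \<phi> (y $ 1)) x = 0"
  by (simp_all add: partial_def axis_def flip: frechet_derivative_at[OF has_derivative_fst_coord[OF assms]])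

lemma matrix_inv_diag:
  assumes "u \<noteq> 0" "v \<noteq> (0::real)"
  shows "matrix_inv (vector [vector [u, 0], vector [0, v]] :: real^2^2)
    = vector [vector [1 / u, 0], vector [0, 1 / v]]"
    (is "matrix_inv ?A = ?B")
proof -
  have AB: "?A ** ?B = mat 1" "?B ** ?A = mat 1"
    using assms by (simp_all add: vec_eq_iff forall_2 matrix_matrix_mult_def sum_2 mat_def)
  have "?A ** matrix_inv ?A = mat 1 \<and> matrix_inv ?A ** ?A = mat 1"
    unfolding matrix_inv_def
    by (rule someI[where P = "\<lambda>B. ?A ** B = mat 1 \<and> B ** ?A = mat 1" and x = ?B]) (simp only: AB simp_thms)
  then have inv: "?A ** matrix_inv ?A = mat 1" by (rule conjunct1)
  have "matrix_inv ?A = ?B ** ?A ** matrix_inv ?A" unfolding AB matrix_mul_lid ..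
  also have "\<dots> = ?B" unfolding matrix_mul_assoc[symmetric] inv matrix_mul_rid ..
  finally show ?thesis .
qed

text \<open>The curvature of \<open>ds\<^sup>2 + f(s)\<^sup>2 dt\<^sup>2\<close> is \<open>K = - f'' / f\<close>, which the differential equation turns into
\<open>c - m * f powr (- a)\<close>. The Ricci equation with \<open>b = 0\<close> says \<open>\<Delta> log \<bar>K - c\<bar> = a K\<close> where \<open>K \<noteq> c\<close>,
after division by \<open>(K - c)\<^sup>2\<close>. Here \<open>log \<bar>K - c\<bar> = log \<bar>m\<bar> - a log f\<close>, and \<open>\<Delta> log f = f'' / f = - K\<close>. The calculation
below works with \<open>K\<close> itself, which also covers \<open>m = 0\<close>.\<close>

lemma ricci_equation_warped_metric:
  fixes f f' :: "real \<Rightarrow> real"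
  assumes pos: "\<And>s. 0 < f s"
    and f1: "\<And>s. (f has_real_derivative f' s) (at s)"
    and f2: "\<And>s. (f' has_real_derivative m * f s powr (1 - a) - c * f s) (at s)"
  shows "ricci_equation a 0 c (warped_metric f) x"
proof -
  let ?g = "warped_metric f"
  note nz = pos[THEN less_imp_neq, symmetric]
  have comp: "(\<lambda>y. ?g y $ 1 $ 1) = (\<lambda>_. 1)" "(\<lambda>y. ?g y $ 1 $ 2) = (\<lambda>_. 0)"
    "(\<lambda>y. ?g y $ 2 $ 1) = (\<lambda>_. 0)" "(\<lambda>y. ?g y $ 2 $ 2) = (\<lambda>y. (f (y $ 1))\<^sup>2)"
    by (simp_all add: warped_metric_def)
  have inv: "matrix_inv (?g y) = vector [vector [1, 0], vector [0, 1 / (f (y $ 1))\<^sup>2]]" for y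
    using nz by (simp add: warped_metric_def matrix_inv_diag)
  have det: "det (?g y) = (f (y $ 1))\<^sup>2" for y by (simp add: warped_metric_def det_2)
  have const: "partial i (\<lambda>_. k) y = 0" for i and k :: real and y
    by (simp add: partial_def)
  have sq: "((\<lambda>s. (f s)\<^sup>2) has_real_derivative 2 * f s * f' s) (at s)" for s
    by (auto intro!: derivative_eq_intros f1)
  note dsq = partial_of_fst_coord[OF sq]
  have chr: "christoffel ?g 1 1 1 = (\<lambda>_. 0)" "christoffel ?g 2 1 1 = (\<lambda>_. 0)"
    "christoffel ?g 1 1 2 = (\<lambda>_. 0)" "christoffel ?g 1 2 1 = (\<lambda>_. 0)"
    "christoffel ?g 2 2 2 = (\<lambda>_. 0)"
    "christoffel ?g 1 2 2 = (\<lambda>y. - (f (y $ 1) * f' (y $ 1)))"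
    "christoffel ?g 2 1 2 = (\<lambda>y. f' (y $ 1) / f (y $ 1))"
    "christoffel ?g 2 2 1 = (\<lambda>y. f' (y $ 1) / f (y $ 1))"
    by (simp_all add: fun_eq_iff christoffel_def sum_2 comp inv const dsq nz)
      (simp_all add: nz field_simps power2_eq_square)
  define K where "K s = c - m * f s powr (- a)" for s
  have powr: "f s powr (1 - a) = f s * f s powr (- a)" for s
    using pos[of s] powr_add[of "f s" 1 "- a"] by simp
  have ff': "((\<lambda>s. - (f s * f' s)) has_real_derivative - ((f' s)\<^sup>2 + f s * (f s * (c - K s) - c * f s))) (at s)" for s
    by (rule derivative_eq_intros f1 f2 refl)+ (simp add: K_def powr algebra_simps power2_eq_square)
  have gauss: "gauss_curvature ?g = (\<lambda>y. K (y $ 1))"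
  proof
    fix y :: "real^2"
    have "gauss_curvature ?g y = (- ((f' (y $ 1))\<^sup>2 + f (y $ 1) * (f (y $ 1) * (c - K (y $ 1)) - c * f (y $ 1)))
        + f' (y $ 1) * f' (y $ 1)) / (f (y $ 1))\<^sup>2"
      using nz by (simp add: gauss_curvature_def riemann_tensor_def sum_2 chr const partial_of_fst_coord[OF ff'] det
          fun_cong[OF comp(1)] fun_cong[OF comp(3)])
    also have "\<dots> = K (y $ 1)" using nz[of "y $ 1"] by (simp add: field_simps power2_eq_square)
    finally show "gauss_curvature ?g y = K (y $ 1)" .
  qed
  have pw: "((\<lambda>s. f s powr (- a)) has_real_derivative - (a * f s powr (- a) * f' s / f s)) (at s)" for s
  proof -
    have "((\<lambda>s. f s powr (- a)) has_real_derivative - a * f s powr (- a - 1) * f' s) (at s)"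
      by (rule DERIV_chain2[OF has_real_derivative_powr[OF pos] f1])
    moreover have "f s powr (- a - 1) = f s powr (- a) / f s"
      using pos[of s] by (simp add: powr_diff)
    ultimately show ?thesis by simp
  qed
  have K1: "(K has_real_derivative a * m * f s powr (- a) * f' s / f s) (at s)" for s
    unfolding K_def by (rule derivative_eq_intros pw refl)+ simp
  note dK = partial_of_fst_coord[OF K1]
  have grad: "gradient ?g (gauss_curvature ?g) = (\<lambda>y. vector [a * m * f (y $ 1) powr (- a) * f' (y $ 1) / f (y $ 1), 0])"
    by (simp add: fun_eq_iff vec_eq_iff forall_2 gradient_def gauss inv dK matrix_vector_mult_def sum_2)
  have flux: "((\<lambda>s. f s * (a * m * f s powr (- a) * f' s / f s)) has_real_derivative
     a * m * (f s powr (- a) * (m * f s powr (1 - a) - c * f s) - a * f s powr (- a) * (f' s)\<^sup>2 / f s)) (at s)" for s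
  proof -
    have "((\<lambda>s. a * m * (f s powr (- a) * f' s)) has_real_derivative
       a * m * (f s powr (- a) * (m * f s powr (1 - a) - c * f s) - a * f s powr (- a) * (f' s)\<^sup>2 / f s)) (at s)"
      by (rule derivative_eq_intros pw f2 refl)+ (simp add: power2_eq_square)
    moreover have "(\<lambda>s. f s * (a * m * f s powr (- a) * f' s / f s)) = (\<lambda>s. a * m * (f s powr (- a) * f' s))"
      using nz by (simp add: fun_eq_iff)
    ultimately show ?thesis by simp
  qed
  have root: "sqrt (det (?g y)) = f (y $ 1)" for y using pos[of "y $ 1"] by (simp add: det)
  have lap: "laplace_beltrami ?g (gauss_curvature ?g) x =
     a * m * (f (x $ 1) powr (- a) * (m * f (x $ 1) powr (1 - a) - c * f (x $ 1))
       - a * f (x $ 1) powr (- a) * (f' (x $ 1))\<^sup>2 / f (x $ 1)) / f (x $ 1)"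
    unfolding laplace_beltrami_def divergence_def grad root
    by (simp add: sum_2 const partial_of_fst_coord[OF flux] del: times_divide_eq_right)
  have norm: "norm_sq ?g x (gradient ?g (gauss_curvature ?g) x) = (a * m * f (x $ 1) powr (- a) * f' (x $ 1) / f (x $ 1))\<^sup>2"
    by (simp add: norm_sq_def grad inner_vec_def sum_2 matrix_vector_mult_def fun_cong[OF comp(1)] fun_cong[OF comp(2)] fun_cong[OF comp(3)] power2_eq_square)
  define u p p' where "u = f (x $ 1) powr (- a)" and "p = f (x $ 1)" and "p' = f' (x $ 1)"
  have p: "p \<noteq> 0" using nz by (simp add: p_def)
  have "a * m * (u * (m * (p * u) - c * p) - a * u * p'\<^sup>2 / p) / p
      = a * m * u * (m * u - c) - a\<^sup>2 * m * u * (p' / p)\<^sup>2"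
    using p by (simp add: divide_simps) (simp add: algebra_simps power2_eq_square)
  moreover have "a * m * u * p' / p = a * m * u * (p' / p)" by simp
  ultimately have "(c - m * u - c) * (a * m * (u * (m * (p * u) - c * p) - a * u * p'\<^sup>2 / p) / p)
      - (a * m * u * p' / p)\<^sup>2 - (a * (c - m * u) + 0) * (c - m * u - c)\<^sup>2 = 0"
    by (simp only:) (simp add: algebra_simps power2_eq_square)
  then show ?thesis
    unfolding ricci_equation_def Let_def lap norm
    unfolding gauss K_def powr
    by (simp only: u_def p_def p'_def)
qed

section \<open>Smoothness\<close>

text \<open>A class of functions closed under differentiation consists of smooth functions. The zero
function must be among them, as the partial derivative in the second coordinate.\<close>

lemma C_k_on_fst_coord:
  assumes closed: "\<And>\<phi>. \<phi> \<in> \<S> \<Longrightarrow> \<exists>\<phi>'\<in>\<S>. \<forall>s. (\<phi> has_real_derivative \<phi>' s) (at s)"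
    and zero: "(\<lambda>_. 0) \<in> \<S>" and "\<phi> \<in> \<S>"
  shows "C_k_on k S (\<lambda>y. \<phi> (y $ 1))"
  using \<open>\<phi> \<in> \<S>\<close>
proof (induction k arbitrary: \<phi>)
  case 0
  then obtain \<phi>' where "\<And>s. (\<phi> has_real_derivative \<phi>' s) (at s)" using closed by blast
  then have "continuous_on UNIV \<phi>"
    by (intro continuous_at_imp_continuous_on ballI DERIV_isCont)
  then show ?case
    by (auto intro!: continuous_on_compose2[of UNIV \<phi>] continuous_intros)
next
  case (Suc k)
  then obtain \<phi>' where \<phi>': "\<phi>' \<in> \<S>" "\<And>s. (\<phi> has_real_derivative \<phi>' s) (at s)"
    using closed by blast
  have "(\<lambda>y :: real^2. \<phi> (y $ 1)) differentiable (at x)" for x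
    using has_derivative_fst_coord[OF \<phi>'(2)] by (rule differentiableI)
  moreover have "partial 1 (\<lambda>y. \<phi> (y $ 1)) = (\<lambda>y. \<phi>' (y $ 1))"
    "partial 2 (\<lambda>y. \<phi> (y $ 1)) = (\<lambda>_. 0)"
    using partial_of_fst_coord[OF \<phi>'(2)] by auto
  ultimately show ?case
    using Suc.IH[OF \<phi>'(1)] Suc.IH[OF zero] by (simp add: forall_2)
qed

text \<open>For a solution \<open>f\<close> of a second order equation whose right-hand side is a combination of powers of
\<open>f\<close>, all derivatives of \<open>f\<close> are polynomials in \<open>f'\<close> with powers of \<open>f\<close> as coefficients. Real exponents
are built in, so that the class is closed under differentiation.\<close>

inductive_set jet_algebra :: "(real \<Rightarrow> real) \<Rightarrow> (real \<Rightarrow> real) \<Rightarrow> (real \<Rightarrow> real) set"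
  for f f' :: "real \<Rightarrow> real" where
  const: "(\<lambda>_. k) \<in> jet_algebra f f'"
| powr: "(\<lambda>s. f s powr \<alpha>) \<in> jet_algebra f f'"
| deriv: "f' \<in> jet_algebra f f'"
| add: "u \<in> jet_algebra f f' \<Longrightarrow> v \<in> jet_algebra f f' \<Longrightarrow> (\<lambda>s. u s + v s) \<in> jet_algebra f f'"
| mult: "u \<in> jet_algebra f f' \<Longrightarrow> v \<in> jet_algebra f f' \<Longrightarrow> (\<lambda>s. u s * v s) \<in> jet_algebra f f'"

lemma jet_algebra_closed_under_derivative:
  assumes pos: "\<And>s. 0 < f s"
    and f1: "\<And>s. (f has_real_derivative f' s) (at s)"
    and f2: "\<And>s. (f' has_real_derivative m * f s powr \<beta> + c * f s) (at s)"
    and u: "u \<in> jet_algebra f f'"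
  shows "\<exists>u'\<in>jet_algebra f f'. \<forall>s. (u has_real_derivative u' s) (at s)"
  using u
proof induction
  case (const k)
  show ?case by (intro bexI[of _ "\<lambda>_. 0"] jet_algebra.const) simp
next
  case (powr \<alpha>)
  show ?case
  proof (intro bexI[of _ "\<lambda>s. \<alpha> * f s powr (\<alpha> - 1) * f' s"] allI)
    show "((\<lambda>s. f s powr \<alpha>) has_real_derivative \<alpha> * f s powr (\<alpha> - 1) * f' s) (at s)" for s
      by (rule DERIV_chain2[OF has_real_derivative_powr[OF pos] f1])
  qed (intro jet_algebra.mult jet_algebra.intros)
next
  case deriv
  \<comment> \<open>The linear term of the force enters the class as a first power.\<close>
  have "(\<lambda>s. m * f s powr \<beta> + c * f s powr 1) \<in> jet_algebra f f'"
    by (intro jet_algebra.add jet_algebra.mult jet_algebra.const jet_algebra.powr)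
  moreover have "(f' has_real_derivative m * f s powr \<beta> + c * f s powr 1) (at s)" for s
    using f2[of s] pos[of s] by simp
  ultimately show ?case by (intro bexI[of _ "\<lambda>s. m * f s powr \<beta> + c * f s powr 1"] allI)
next
  case (add u v)
  then obtain u' v' where "u' \<in> jet_algebra f f'" "v' \<in> jet_algebra f f'"
    "\<And>s. (u has_real_derivative u' s) (at s)" "\<And>s. (v has_real_derivative v' s) (at s)" by blast
  then show ?case
    by (intro bexI[of _ "\<lambda>s. u' s + v' s"] jet_algebra.add allI DERIV_add)
next
  case (mult u v)
  then obtain u' v' where *: "u' \<in> jet_algebra f f'" "v' \<in> jet_algebra f f'"
    "\<And>s. (u has_real_derivative u' s) (at s)" "\<And>s. (v has_real_derivative v' s) (at s)" by blast
  have "(\<lambda>s. u' s * v s + v' s * u s) \<in> jet_algebra f f'"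
    using * mult.hyps by (intro jet_algebra.add jet_algebra.mult)
  moreover have "\<forall>s. ((\<lambda>s. u s * v s) has_real_derivative u' s * v s + v' s * u s) (at s)"
    using * by (intro allI DERIV_mult)
  ultimately show ?case by (intro bexI[of _ "\<lambda>s. u' s * v s + v' s * u s"])
qed

lemma smooth_on_warped_metric:
  assumes pos: "\<And>s. 0 < f s"
    and f1: "\<And>s. (f has_real_derivative f' s) (at s)"
    and f2: "\<And>s. (f' has_real_derivative m * f s powr \<beta> + c * f s) (at s)"
  shows "smooth_on S (\<lambda>x. warped_metric f x $ i $ j)"
proof -
  have sq: "(\<lambda>s. (f s)\<^sup>2) = (\<lambda>s. f s powr 2)" using pos by (simp add: fun_eq_iff powr_numeral less_imp_le)
  have "\<exists>\<phi>\<in>jet_algebra f f'. (\<lambda>x. warped_metric f x $ i $ j) = (\<lambda>x. \<phi> (x $ 1))"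
  proof -
    have "\<forall>i j. (\<lambda>x. warped_metric f x $ i $ j) = (\<lambda>_. 1) \<or>
        (\<lambda>x. warped_metric f x $ i $ j) = (\<lambda>_. 0) \<or>
        (\<lambda>x. warped_metric f x $ i $ j) = (\<lambda>x. (f (x $ 1))\<^sup>2)"
      by (simp add: forall_2 warped_metric_def)
    from this[rule_format, of i j] show ?thesis
    proof (elim disjE)
      assume 1: "(\<lambda>x. warped_metric f x $ i $ j) = (\<lambda>_. 1)"
      show ?thesis unfolding 1 by (rule bexI[OF _ jet_algebra.const]) (rule refl)
    next
      assume 2: "(\<lambda>x. warped_metric f x $ i $ j) = (\<lambda>_. 0)"
      show ?thesis unfolding 2 by (rule bexI[OF _ jet_algebra.const]) (rule refl)
    next
      assume 3: "(\<lambda>x. warped_metric f x $ i $ j) = (\<lambda>x. (f (x $ 1))\<^sup>2)"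
      show ?thesis unfolding 3 by (rule bexI[OF _ jet_algebra.powr[of f 2]]) (rule ext, rule fun_cong[OF sq])
    qed
  qed
  then obtain \<phi> where \<phi>: "\<phi> \<in> jet_algebra f f'" "(\<lambda>x. warped_metric f x $ i $ j) = (\<lambda>x. \<phi> (x $ 1))"
    by blast
  show ?thesis
    unfolding smooth_on_def \<phi>(2)
    by (intro allI C_k_on_fst_coord[where \<S> = "jet_algebra f f'"]
        jet_algebra_closed_under_derivative[OF pos f1 f2] jet_algebra.const \<phi>(1))
qed

text \<open>Both differentiability and partial derivatives depend only on the germ of a function. This
allows a function that is a translation near each point, but by varying vectors, to be handled
on its whole domain.\<close>

lemma C_k_on_local:
  assumes "\<And>x. x \<in> S \<Longrightarrow> \<exists>N v. open N \<and> x \<in> N \<and> (\<forall>y\<in>N. v y = u y) \<and> C_k_on k N v"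
  shows "C_k_on k S u"
  using assms
proof (induction k arbitrary: u)
  case 0
  have "isCont u x" if "x \<in> S" for x
  proof -
    obtain N v where N: "open N" "x \<in> N" "\<forall>y\<in>N. v y = u y" "continuous_on N v"
      using 0[OF \<open>x \<in> S\<close>] by auto
    then have "continuous_on N u" by (simp cong: continuous_on_cong)
    then show ?thesis using N by (simp add: continuous_on_eq_continuous_at)
  qed
  then show ?case by (simp add: continuous_at_imp_continuous_on)
next
  case (Suc k)
  have "u differentiable (at x) \<and> (\<forall>i. \<exists>N w. open N \<and> x \<in> N \<and> (\<forall>y\<in>N. w y = partial i u y) \<and> C_k_on k N w)"
    if "x \<in> S" for x
  proof -
    obtain N v where N: "open N" "x \<in> N" "\<And>y. y \<in> N \<Longrightarrow> v y = u y" "\<And>y. y \<in> N \<Longrightarrow> v differentiable (at y)"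
      "\<And>i. C_k_on k N (partial i v)"
      using Suc.prems[OF \<open>x \<in> S\<close>] by auto
    have "u differentiable (at x)"
      using N has_derivative_transform_within_open[of v _ x UNIV N u] unfolding differentiable_def by blast
    moreover have "partial i v y = partial i u y" if "y \<in> N" for i y
      using frechet_derivative_transform_within_open[of v y N u] N that by (simp add: partial_def)
    ultimately show ?thesis using N by blast
  qed
  then show ?case using Suc.IH by simp
qed

lemma smooth_on_translation: "smooth_on S (\<lambda>x. (x + \<gamma>) $ i)"
proof -
  have const: "C_k_on k S (\<lambda>_. d)" for k d and S
    by (induction k arbitrary: d) (simp_all add: partial_def[abs_def])
  have der: "((\<lambda>x. (x + \<gamma>) $ i) has_derivative (\<lambda>h. h $ i)) (at x)" for x
  proof -
    have "((\<lambda>x. x $ i + \<gamma> $ i) has_derivative (\<lambda>h. h $ i + 0)) (at x)"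
      by (intro has_derivative_add has_derivative_const
          bounded_linear_imp_has_derivative bounded_linear_vec_nth)
    then show ?thesis by simp
  qed
  have partial: "partial j (\<lambda>x. (x + \<gamma>) $ i) = (\<lambda>_. axis j 1 $ i)" for j
    by (rule ext) (simp only: partial_def frechet_derivative_at[OF der, symmetric])
  have "C_k_on k S (\<lambda>x. (x + \<gamma>) $ i)" for k
    by (cases k) (auto simp only: C_k_on.simps partial intro!: const continuous_intros differentiableI[OF der])
  then show ?thesis by (simp add: smooth_on_def)
qed

text \<open>The coordinate changes of a quotient by translations have this form; the translation vector
may differ from one component of the overlap of two charts to another.\<close>

definition locally_translation_on :: "(real^2) set \<Rightarrow> (real^2) set \<Rightarrow> (real^2 \<Rightarrow> real^2) \<Rightarrow> bool" where
  "locally_translation_on \<Gamma> S F \<longleftrightarrow>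
     (\<forall>x\<in>S. \<exists>N. \<exists>\<gamma>\<in>\<Gamma>. open N \<and> x \<in> N \<and> (\<forall>y\<in>N. F y = y + \<gamma>))"

lemma smooth_map_on_locally_translation:
  assumes "locally_translation_on \<Gamma> S F"
  shows "smooth_map_on S F"
  unfolding smooth_map_on_def smooth_on_def
proof (intro allI C_k_on_local)
  fix i k x assume "x \<in> S"
  then obtain N \<gamma> where "open N" "x \<in> N" "\<forall>y\<in>N. F y = y + \<gamma>"
    using assms unfolding locally_translation_on_def by blast
  moreover have "C_k_on k N (\<lambda>y. (y + \<gamma>) $ i)"
    using smooth_on_translation unfolding smooth_on_def by blast
  ultimately show "\<exists>N v. open N \<and> x \<in> N \<and> (\<forall>y\<in>N. v y = F y $ i) \<and> C_k_on k N v"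
    by (intro exI[of _ N] exI[of _ "\<lambda>y. (y + \<gamma>) $ i"]) simp
qed

text \<open>The Jacobian of a translation is the identity, so only the base point of the metric moves.\<close>

lemma pullback_metric_locally_translation:
  assumes F: "locally_translation_on \<Gamma> S F" and "x \<in> S"
    and invariant: "\<And>x \<gamma>. \<gamma> \<in> \<Gamma> \<Longrightarrow> h (x + \<gamma>) = h x"
  shows "pullback_metric F h x = h x"
proof -
  obtain N \<gamma> where N: "\<gamma> \<in> \<Gamma>" "open N" "x \<in> N" "\<And>y. y \<in> N \<Longrightarrow> y + \<gamma> = F y"
    using assms unfolding locally_translation_on_def by metis
  have "((\<lambda>y. y + \<gamma>) has_derivative id) (at x)"
    unfolding id_def using has_derivative_add[OF has_derivative_ident has_derivative_const] by simp
  then have "(F has_derivative id) (at x)"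
    using has_derivative_transform_within_open N(2-4) by blast
  then have "frechet_derivative F (at x) = id" by (rule frechet_derivative_at[symmetric])
  then have "jacobian F (at x) = mat 1" by (simp add: jacobian_def matrix_id_mat_1)
  moreover have "h (F x) = h x" using invariant[OF N(1), of x] N(4)[OF N(3)] by simp
  ultimately show ?thesis by (simp add: pullback_metric_def)
qed

section \<open>Quotients of the plane by groups of translations\<close>

lemma second_countable_plane: "second_countable (euclidean :: (real^2) topology)"
proof -
  obtain B :: "(real^2) set set" where B: "countable B" "topological_basis B"
    using ex_countable_basis by blast
  show ?thesis unfolding second_countable_def
  proof (intro exI[of _ B] conjI ballI allI impI)
    show "openin euclidean V" if "V \<in> B" for V using topological_basis_open[OF B(2) that] by simp
    show "\<exists>V\<in>B. x \<in> V \<and> V \<subseteq> U" if "openin euclidean U \<and> x \<in> U" for U x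
      using topological_basisE[OF B(2), of U x] that by auto
  qed (rule B)
qed

locale translation_group =
  fixes \<Gamma> :: "(real^2) set"
  assumes zero: "0 \<in> \<Gamma>"
    and add: "\<gamma> \<in> \<Gamma> \<Longrightarrow> \<delta> \<in> \<Gamma> \<Longrightarrow> \<gamma> + \<delta> \<in> \<Gamma>"
    and neg: "\<gamma> \<in> \<Gamma> \<Longrightarrow> - \<gamma> \<in> \<Gamma>"
begin

abbreviation "\<pi> \<equiv> coset_proj \<Gamma>"
abbreviation "M \<equiv> quotient_plane \<Gamma>"

lemma coset_proj_eq_iff: "\<pi> x = \<pi> y \<longleftrightarrow> y - x \<in> \<Gamma>"
proof
  assume "\<pi> x = \<pi> y"
  then have "y + 0 \<in> \<pi> x" using zero unfolding coset_proj_def by blast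
  then obtain \<gamma> where "\<gamma> \<in> \<Gamma>" "y + 0 = x + \<gamma>" unfolding coset_proj_def by blast
  then show "y - x \<in> \<Gamma>" by simp
next
  have sub: "\<pi> y \<subseteq> \<pi> x" if "y - x \<in> \<Gamma>" for x y
  proof
    fix z assume "z \<in> \<pi> y"
    then obtain \<gamma> where \<gamma>: "\<gamma> \<in> \<Gamma>" "z = y + \<gamma>" unfolding coset_proj_def by blast
    then have "z = x + (y - x + \<gamma>)" by simp
    then show "z \<in> \<pi> x" using add[OF that \<gamma>(1)] unfolding coset_proj_def by blast
  qed
  assume yx: "y - x \<in> \<Gamma>"
  then have "x - y \<in> \<Gamma>" using neg[OF yx] by simp
  then show "\<pi> x = \<pi> y" using sub yx by blast
qed

lemma coset_proj_add: "\<gamma> \<in> \<Gamma> \<Longrightarrow> \<pi> (x + \<gamma>) = \<pi> x"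
  using neg by (simp add: coset_proj_eq_iff)

lemma openin_quotient_plane: "openin M W \<longleftrightarrow> W \<subseteq> range \<pi> \<and> open (\<pi> -` W)"
proof -
  have "istopology (\<lambda>W. W \<subseteq> range \<pi> \<and> open (\<pi> -` W))"
    unfolding istopology_def
  proof (intro conjI allI impI)
    fix S T assume "S \<subseteq> range \<pi> \<and> open (\<pi> -` S)" "T \<subseteq> range \<pi> \<and> open (\<pi> -` T)"
    then show "S \<inter> T \<subseteq> range \<pi>" "open (\<pi> -` (S \<inter> T))" by (auto simp: vimage_Int)
  next
    fix K assume K: "\<forall>S\<in>K. S \<subseteq> range \<pi> \<and> open (\<pi> -` S)"
    then show "\<Union>K \<subseteq> range \<pi>" by blast
    show "open (\<pi> -` \<Union>K)" unfolding vimage_Union using K by blast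
  qed
  then show ?thesis unfolding quotient_plane_def by (simp only: topology_inverse')
qed

lemma topspace_quotient_plane: "topspace M = range \<pi>"
proof
  show "topspace M \<subseteq> range \<pi>" using openin_topspace[of M] unfolding openin_quotient_plane by blast
  have "\<pi> -` range \<pi> = UNIV" by blast
  then have "openin M (range \<pi>)" by (simp add: openin_quotient_plane)
  then show "range \<pi> \<subseteq> topspace M" by (rule openin_subset)
qed

lemma quotient_map_coset_proj: "quotient_map euclidean M \<pi>"
  unfolding quotient_map_def topspace_quotient_plane openin_quotient_plane
  by (simp add: vimage_def)

lemma continuous_map_coset_proj: "continuous_map euclidean M \<pi>"
  using quotient_map_coset_proj by (rule quotient_imp_continuous_map)

text \<open>The saturation of an open set is a union of translates of it.\<close>

lemma open_map_coset_proj: "open_map euclidean M \<pi>"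
  unfolding open_map_def
proof (intro allI impI)
  fix U :: "(real^2) set" assume "openin euclidean U"
  then have U: "open U" by simp
  have "\<pi> -` (\<pi> ` U) = (\<Union>\<gamma>\<in>\<Gamma>. (\<lambda>x. \<gamma> + x) ` U)"
  proof (intro set_eqI iffI)
    fix x assume "x \<in> \<pi> -` (\<pi> ` U)"
    then obtain u where u: "u \<in> U" "\<pi> u = \<pi> x" by auto
    then have "x - u \<in> \<Gamma>" by (simp add: coset_proj_eq_iff)
    moreover have "x = (x - u) + u" by simp
    ultimately show "x \<in> (\<Union>\<gamma>\<in>\<Gamma>. (\<lambda>x. \<gamma> + x) ` U)" using u(1) by blast
  next
    fix x assume "x \<in> (\<Union>\<gamma>\<in>\<Gamma>. (\<lambda>x. \<gamma> + x) ` U)"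
    then obtain \<gamma> u where "\<gamma> \<in> \<Gamma>" "u \<in> U" "x = \<gamma> + u" by blast
    then have "\<pi> x = \<pi> u" using coset_proj_add by (simp add: add.commute)
    then show "x \<in> \<pi> -` (\<pi> ` U)" using \<open>u \<in> U\<close> by simp
  qed
  moreover have "open \<dots>" using U by (intro open_UN ballI open_translation)
  ultimately show "openin M (\<pi> ` U)" by (auto simp: openin_quotient_plane)
qed

lemma homeomorphic_map_quotient_chart:
  assumes V: "open V" "inj_on \<pi> V"
  shows "homeomorphic_map (subtopology M (\<pi> ` V)) (top_of_set V) (inv_into V \<pi>)"
proof -
  have "homeomorphic_map (top_of_set V) (subtopology M (\<pi> ` V)) \<pi>"
  proof (rule bijective_open_imp_homeomorphic_map)
    show "continuous_map (top_of_set V) (subtopology M (\<pi> ` V)) \<pi>"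
      by (intro continuous_map_into_subtopology continuous_map_from_subtopology continuous_map_coset_proj) auto
    show "open_map (top_of_set V) (subtopology M (\<pi> ` V)) \<pi>"
    proof (rule open_map_into_subtopology)
      show "open_map (top_of_set V) M \<pi>"
        using V(1) open_map_coset_proj by (intro open_map_from_subtopology) auto
    qed auto
    show "\<pi> ` topspace (top_of_set V) = topspace (subtopology M (\<pi> ` V))"
      by (auto simp: topspace_quotient_plane)
    show "inj_on \<pi> (topspace (top_of_set V))" using V(2) by simp
  qed
  then obtain g where g: "homeomorphic_maps (top_of_set V) (subtopology M (\<pi> ` V)) \<pi> g"
    unfolding homeomorphic_map_maps by blast
  have hg: "homeomorphic_map (subtopology M (\<pi> ` V)) (top_of_set V) g"
    and g_eq: "\<And>v. v \<in> V \<Longrightarrow> g (\<pi> v) = v"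
    using g by (auto simp: homeomorphic_maps_map)
  show ?thesis
  proof (rule homeomorphic_map_eq[OF hg])
    fix C assume "C \<in> topspace (subtopology M (\<pi> ` V))"
    then obtain v where "v \<in> V" "C = \<pi> v" by auto
    then show "g C = inv_into V \<pi> C" using g_eq V(2) by simp
  qed
qed

text \<open>If \<open>\<gamma>\<close> moves \<open>x\<close> to the point of \<open>V\<close> in its class, then it also moves all points near \<open>x\<close> into
\<open>V\<close>, since \<open>V\<close> is open, and there the representative in \<open>V\<close> is unique.\<close>

lemma quotient_chart_locally_translation:
  assumes V: "open V" "inj_on \<pi> V" and S: "\<And>x. x \<in> S \<Longrightarrow> \<pi> x \<in> \<pi> ` V"
  shows "locally_translation_on \<Gamma> S (inv_into V \<pi> \<circ> \<pi>)"
  unfolding locally_translation_on_def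
proof
  fix x assume "x \<in> S"
  then obtain x' where x': "x' \<in> V" "\<pi> x = \<pi> x'" using S by blast
  define \<gamma> where "\<gamma> = x' - x"
  have \<gamma>: "\<gamma> \<in> \<Gamma>" using x' by (simp add: coset_proj_eq_iff \<gamma>_def)
  define N where "N = (\<lambda>y. y + \<gamma>) -` V"
  have "open N" unfolding N_def
    by (intro open_vimage V(1) continuous_intros)
  moreover have "x \<in> N" using x' by (simp add: N_def \<gamma>_def)
  moreover have "(inv_into V \<pi> \<circ> \<pi>) y = y + \<gamma>" if "y \<in> N" for y
    using that inv_into_f_f[OF V(2), of "y + \<gamma>"] coset_proj_add[OF \<gamma>, of y] by (simp add: N_def)
  ultimately show "\<exists>N. \<exists>\<gamma>\<in>\<Gamma>. open N \<and> x \<in> N \<and> (\<forall>y\<in>N. (inv_into V \<pi> \<circ> \<pi>) y = y + \<gamma>)"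
    using \<gamma> by blast
qed

lemma quotient_chart_image: "inj_on \<pi> V \<Longrightarrow> inv_into V \<pi> ` \<pi> ` V = V"
  by (simp add: inv_into_image_cancel)

lemma inv_into_quotient_chart:
  assumes V: "inj_on \<pi> V" and "x \<in> V"
  shows "inv_into (\<pi> ` V) (inv_into V \<pi>) x = \<pi> x"
proof -
  have "inj_on (inv_into V \<pi>) (\<pi> ` V)" by (simp add: inj_on_inv_into)
  then have "inv_into (\<pi> ` V) (inv_into V \<pi>) (inv_into V \<pi> (\<pi> x)) = \<pi> x"
    by (rule inv_into_f_f) (use \<open>x \<in> V\<close> in blast)
  then show ?thesis using V \<open>x \<in> V\<close> by simp
qed

lemma transition_of_charts_locally_translation:
  assumes V: "open V" "inj_on \<pi> V" and W: "open W" "inj_on \<pi> W"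
  shows "locally_translation_on \<Gamma> (inv_into V \<pi> ` (\<pi> ` V \<inter> \<pi> ` W))
    (inv_into W \<pi> \<circ> inv_into (\<pi> ` V) (inv_into V \<pi>))"
  unfolding locally_translation_on_def
proof
  let ?S = "inv_into V \<pi> ` (\<pi> ` V \<inter> \<pi> ` W)"
  have S: "x \<in> V \<and> \<pi> x \<in> \<pi> ` W" if xS: "x \<in> ?S" for x
  proof -
    obtain C where C: "x = inv_into V \<pi> C" "C \<in> \<pi> ` V \<inter> \<pi> ` W" using xS by (rule imageE)
    have "x \<in> V" unfolding C(1) by (rule inv_into_into) (rule IntD1[OF C(2)])
    moreover have "\<pi> x = C" unfolding C(1) by (rule f_inv_into_f) (rule IntD1[OF C(2)])
    ultimately show ?thesis using IntD2[OF C(2)] by simp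
  qed
  have "locally_translation_on \<Gamma> ?S (inv_into W \<pi> \<circ> \<pi>)"
    using S by (intro quotient_chart_locally_translation W) blast
  moreover fix x assume x: "x \<in> ?S"
  ultimately obtain N \<gamma> where N: "\<gamma> \<in> \<Gamma>" "open N" "x \<in> N" "\<And>y. y \<in> N \<Longrightarrow> (inv_into W \<pi> \<circ> \<pi>) y = y + \<gamma>"
    unfolding locally_translation_on_def by blast
  show "\<exists>N. \<exists>\<gamma>\<in>\<Gamma>. open N \<and> x \<in> N \<and>
      (\<forall>y\<in>N. (inv_into W \<pi> \<circ> inv_into (\<pi> ` V) (inv_into V \<pi>)) y = y + \<gamma>)"
  proof (intro exI[of _ "N \<inter> V"] bexI[of _ \<gamma>] conjI ballI)
    show "open (N \<inter> V)" using N V by blast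
    show "x \<in> N \<inter> V" using N S x by blast
    show "(inv_into W \<pi> \<circ> inv_into (\<pi> ` V) (inv_into V \<pi>)) y = y + \<gamma>" if "y \<in> N \<inter> V" for y
      using N(4)[of y] inv_into_quotient_chart[OF V(2), of y] that by simp
  qed (rule N)
qed

lemma transition_locally_translation:
  assumes "p \<in> quotient_atlas \<Gamma>" "q \<in> quotient_atlas \<Gamma>"
  shows "locally_translation_on \<Gamma> (snd p ` (fst p \<inter> fst q)) (snd q \<circ> inv_into (fst p) (snd p))"
proof -
  obtain V where V: "open V" "inj_on \<pi> V" and p: "p = (\<pi> ` V, inv_into V \<pi>)"
    using assms(1) unfolding quotient_atlas_def by blast
  obtain W where W: "open W" "inj_on \<pi> W" and q: "q = (\<pi> ` W, inv_into W \<pi>)"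
    using assms(2) unfolding quotient_atlas_def by blast
  show ?thesis
    unfolding p q fst_conv snd_conv by (rule transition_of_charts_locally_translation[OF V W])
qed

text \<open>Discreteness of the group makes small balls inject into the quotient, so that the charts cover it.
Countability and connectedness are inherited from the plane because the projection is open,
continuous and surjective. The Hausdorff property is a hypothesis; for the lattice it comes
from the identification with a torus.\<close>

lemma smooth_surface_quotient_plane:
  assumes haus: "Hausdorff_space M"
    and discrete: "\<epsilon> > 0" "\<And>\<gamma>. \<gamma> \<in> \<Gamma> \<Longrightarrow> \<gamma> \<noteq> 0 \<Longrightarrow> \<epsilon> \<le> norm \<gamma>"
  shows "smooth_surface M (quotient_atlas \<Gamma>)"
proof -
  have "second_countable M"
    using second_countable_open_map_image[OF continuous_map_coset_proj open_map_coset_proj] second_countable_plane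
    by (simp add: topspace_quotient_plane)
  moreover have "connected_space M"
  proof (rule connected_space_quotient_map_image[OF quotient_map_coset_proj])
    show "connected_space (euclidean :: (real^2) topology)"
      using connectedin_topspace[of "euclidean :: (real^2) topology"] connected_UNIV[where 'a = "real^2"] by simp
  qed
  moreover have "(\<Union>p\<in>quotient_atlas \<Gamma>. fst p) = topspace M"
  proof
    show "(\<Union>p\<in>quotient_atlas \<Gamma>. fst p) \<subseteq> topspace M"
      by (auto simp: quotient_atlas_def topspace_quotient_plane)
    show "topspace M \<subseteq> (\<Union>p\<in>quotient_atlas \<Gamma>. fst p)"
    proof
      fix C assume "C \<in> topspace M"
      then obtain x where x: "C = \<pi> x" by (auto simp: topspace_quotient_plane)
      define V where "V = ball x (\<epsilon> / 2)"
      have "inj_on \<pi> V"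
      proof
        fix y z assume yz: "y \<in> V" "z \<in> V" "\<pi> y = \<pi> z"
        have "norm (z - y) < \<epsilon>"
          using dist_triangle_half_r[of x y \<epsilon> z] yz by (simp add: V_def dist_norm norm_minus_commute)
        then have "z - y = 0" using discrete(2)[of "z - y"] yz(3) by (force simp: coset_proj_eq_iff)
        then show "y = z" by simp
      qed
      then have "(\<pi> ` V, inv_into V \<pi>) \<in> quotient_atlas \<Gamma>"
        unfolding quotient_atlas_def V_def by blast
      moreover have "C \<in> fst (\<pi> ` V, inv_into V \<pi>)" using x discrete(1) by (simp add: V_def)
      ultimately show "C \<in> (\<Union>p\<in>quotient_atlas \<Gamma>. fst p)" by (rule UN_I)
    qed
  qed
  moreover have "openin M (fst p) \<and> open (snd p ` fst p) \<and>
      homeomorphic_map (subtopology M (fst p)) (top_of_set (snd p ` fst p)) (snd p)"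
    if p: "p \<in> quotient_atlas \<Gamma>" for p
  proof -
    obtain V where V: "open V" "inj_on \<pi> V" and eq: "p = (\<pi> ` V, inv_into V \<pi>)"
      using p unfolding quotient_atlas_def by blast
    show ?thesis
      unfolding eq fst_conv snd_conv quotient_chart_image[OF V(2)]
      using V open_map_coset_proj homeomorphic_map_quotient_chart[OF V] by (simp add: open_map_def)
  qed
  moreover have "smooth_map_on (snd p ` (fst p \<inter> fst q)) (snd q \<circ> inv_into (fst p) (snd p))"
    if "p \<in> quotient_atlas \<Gamma>" "q \<in> quotient_atlas \<Gamma>" for p q
    using transition_locally_translation[OF that] by (rule smooth_map_on_locally_translation)
  ultimately show ?thesis
    unfolding smooth_surface_def case_prod_beta using haus by (intro conjI ballI) simp_all
qed

lemma riemannian_metric_quotient: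
  assumes smooth: "\<And>S i j. smooth_on S (\<lambda>x. \<sigma> x $ i $ j)"
    and symmetric: "\<And>x. transpose (\<sigma> x) = \<sigma> x"
    and pos: "\<And>x v. v \<noteq> 0 \<Longrightarrow> 0 < v \<bullet> (\<sigma> x *v v)"
    and invariant: "\<And>x \<gamma>. \<gamma> \<in> \<Gamma> \<Longrightarrow> \<sigma> (x + \<gamma>) = \<sigma> x"
  shows "riemannian_metric (quotient_atlas \<Gamma>) (quotient_metric \<sigma>)"
  unfolding riemannian_metric_def quotient_metric_def case_prod_beta
proof (intro conjI ballI allI impI smooth symmetric pos)
  fix p q x assume "p \<in> quotient_atlas \<Gamma>" "q \<in> quotient_atlas \<Gamma>" and x: "x \<in> snd p ` (fst p \<inter> fst q)"
  from transition_locally_translation[OF this(1,2)] x invariant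
  have "pullback_metric (snd q \<circ> inv_into (fst p) (snd p)) \<sigma> x = \<sigma> x"
    by (rule pullback_metric_locally_translation)
  then show "\<sigma> x = pullback_metric (snd q \<circ> inv_into (fst p) (snd p)) \<sigma> x" by (rule HOL.sym)
qed

lemma local_isometry_coset_proj:
  assumes invariant: "\<And>x \<gamma>. \<gamma> \<in> \<Gamma> \<Longrightarrow> \<sigma> (x + \<gamma>) = \<sigma> x"
  shows "local_isometry euclidean plane_atlas (plane_metric \<sigma>) M (quotient_atlas \<Gamma>) (quotient_metric \<sigma>) \<pi>"
proof -
  have trans: "locally_translation_on \<Gamma> (\<pi> -` fst q) (snd q \<circ> \<pi>)" if "q \<in> quotient_atlas \<Gamma>" for q
    using that unfolding quotient_atlas_def by (auto intro!: quotient_chart_locally_translation)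
  have smooth: "smooth_map_on (\<pi> -` fst q) (snd q \<circ> \<pi>)" if "q \<in> quotient_atlas \<Gamma>" for q
    using trans[OF that] by (rule smooth_map_on_locally_translation)
  have pull: "pullback_metric (snd q \<circ> \<pi>) \<sigma> x = \<sigma> x" if "q \<in> quotient_atlas \<Gamma>" "\<pi> x \<in> fst q" for q x
    using that by (intro pullback_metric_locally_translation[OF trans[OF that(1)] _ invariant]) simp
  show ?thesis
    unfolding local_isometry_def plane_atlas_def plane_metric_def quotient_metric_def case_prod_beta
    by (simp add: continuous_map_coset_proj inv_id smooth pull)
qed

end

section \<open>The lattice and the torus\<close>

lemma mem_lattice_iff:
  "\<gamma> \<in> lattice T \<gamma>1 \<gamma>2 \<longleftrightarrow> (\<exists>(j::int) (k::int). \<gamma> $ 1 = j * T \<and> \<gamma> $ 2 = j * \<gamma>1 + k * \<gamma>2)"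
  unfolding lattice_def by (simp add: vec_eq_iff forall_2)

lemma translation_group_lattice: "translation_group (lattice T \<gamma>1 \<gamma>2)"
proof
  show "0 \<in> lattice T \<gamma>1 \<gamma>2"
    unfolding mem_lattice_iff by (intro exI[of _ 0]) simp
next
  fix \<gamma> \<delta> assume "\<gamma> \<in> lattice T \<gamma>1 \<gamma>2" "\<delta> \<in> lattice T \<gamma>1 \<gamma>2"
  then obtain j k j' k' :: int where "\<gamma> $ 1 = j * T" "\<gamma> $ 2 = j * \<gamma>1 + k * \<gamma>2"
    "\<delta> $ 1 = j' * T" "\<delta> $ 2 = j' * \<gamma>1 + k' * \<gamma>2"
    unfolding mem_lattice_iff by blast
  then show "\<gamma> + \<delta> \<in> lattice T \<gamma>1 \<gamma>2"
    unfolding mem_lattice_iff by (intro exI[of _ "j + j'"] exI[of _ "k + k'"]) (simp add: algebra_simps)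
next
  fix \<gamma> assume "\<gamma> \<in> lattice T \<gamma>1 \<gamma>2"
  then obtain j k :: int where "\<gamma> $ 1 = j * T" "\<gamma> $ 2 = j * \<gamma>1 + k * \<gamma>2"
    unfolding mem_lattice_iff by blast
  then show "- \<gamma> \<in> lattice T \<gamma>1 \<gamma>2"
    unfolding mem_lattice_iff by (intro exI[of _ "- j"] exI[of _ "- k"]) simp
qed

lemma lattice_discrete:
  assumes T: "0 < T" and "\<gamma>2 \<noteq> 0" and \<gamma>: "\<gamma> \<in> lattice T \<gamma>1 \<gamma>2" "\<gamma> \<noteq> 0"
  shows "min T \<bar>\<gamma>2\<bar> \<le> norm \<gamma>"
proof -
  obtain j k :: int where jk: "\<gamma> $ 1 = j * T" "\<gamma> $ 2 = j * \<gamma>1 + k * \<gamma>2"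
    using \<gamma>(1) unfolding mem_lattice_iff by blast
  have scale: "r \<le> \<bar>of_int n * r\<bar>" if "n \<noteq> 0" "0 < r" for n :: int and r :: real
  proof -
    have "1 \<le> \<bar>real_of_int n\<bar>" using that by linarith
    then show ?thesis using that by (simp add: abs_mult)
  qed
  show ?thesis
  proof (cases "j = 0")
    case True
    then have "k \<noteq> 0" using jk \<gamma>(2) by (auto simp: vec_eq_iff forall_2)
    then have "\<bar>\<gamma>2\<bar> \<le> \<bar>\<gamma> $ 2\<bar>" using scale[of k "\<bar>\<gamma>2\<bar>"] jk True \<open>\<gamma>2 \<noteq> 0\<close> by (simp add: abs_mult)
    then show ?thesis using component_le_norm_cart[of \<gamma> 2] by linarith
  next
    case False
    then have "T \<le> \<bar>\<gamma> $ 1\<bar>" using scale[of j T] jk T by simp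
    then show ?thesis using component_le_norm_cart[of \<gamma> 1] by linarith
  qed
qed

lemma cis_eq_iff: "cis u = cis v \<longleftrightarrow> (\<exists>n :: int. v - u = n * (2 * pi))"
proof -
  have "cis u = cis v \<longleftrightarrow> sin v = sin u \<and> cos v = cos u" by (auto simp: complex_eq_iff)
  also have "\<dots> \<longleftrightarrow> (\<exists>n :: int. v = u + 2 * pi * n)" by (rule sin_cos_eq_iff)
  finally show ?thesis by (simp add: algebra_simps)
qed

lemma Hausdorff_space_torus: "Hausdorff_space torus_topology"
  by (simp add: torus_topology_def Hausdorff_space_prod_topology Hausdorff_space_subtopology)

text \<open>The coordinates of a point with respect to the lattice basis \<open>(T, \<gamma>1)\<close>, \<open>(0, \<gamma>2)\<close>, taken modulo \<open>1\<close>
and wrapped around the unit circle, give a continuous surjection \<open>\<Phi>\<close> of the plane onto the torus that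
identifies exactly the points congruent modulo the lattice. It descends to a continuous bijection from
the quotient, which is compact as the image of a compact rectangle, to a Hausdorff space, and such a
bijection is a homeomorphism.\<close>

lemma quotient_plane_lattice_homeomorphic_torus:
  assumes T: "0 < T" and \<gamma>2: "\<gamma>2 \<noteq> 0"
  shows "quotient_plane (lattice T \<gamma>1 \<gamma>2) homeomorphic_space torus_topology"
proof -
  let ?\<Gamma> = "lattice T \<gamma>1 \<gamma>2"
  interpret translation_group ?\<Gamma> by (rule translation_group_lattice)
  define \<Phi> :: "real^2 \<Rightarrow> complex \<times> complex" where
    "\<Phi> x = (cis (2 * pi * (x $ 1 / T)), cis (2 * pi * ((x $ 2 - \<gamma>1 * (x $ 1 / T)) / \<gamma>2)))" for x
  have \<Phi>_eq_iff: "\<Phi> x = \<Phi> y \<longleftrightarrow> y - x \<in> ?\<Gamma>" for x y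
  proof -
    have cis: "cis (2 * pi * u) = cis (2 * pi * v) \<longleftrightarrow> (\<exists>n :: int. v = u + n)" for u v
    proof -
      have "2 * pi * v - 2 * pi * u = real_of_int n * (2 * pi) \<longleftrightarrow> v = u + n" for n :: int
      proof -
        have "2 * pi * v - 2 * pi * u = real_of_int n * (2 * pi) \<longleftrightarrow> (v - u) * (2 * pi) = n * (2 * pi)"
          by (simp add: algebra_simps)
        also have "\<dots> \<longleftrightarrow> v - u = n" by simp
        finally show ?thesis by linarith
      qed
      then show ?thesis unfolding cis_eq_iff by simp
    qed
    have 1: "y $ 1 / T = x $ 1 / T + j \<longleftrightarrow> (y - x) $ 1 = j * T" for j
      using T by (auto simp: field_simps)
    have 2: "(y $ 2 - \<gamma>1 * (y $ 1 / T)) / \<gamma>2 = (x $ 2 - \<gamma>1 * (x $ 1 / T)) / \<gamma>2 + k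
        \<longleftrightarrow> (y - x) $ 2 = j * \<gamma>1 + k * \<gamma>2" if "y $ 1 / T = x $ 1 / T + j" for j k
      unfolding that using \<gamma>2 by (auto simp: field_simps)
    have "\<Phi> x = \<Phi> y \<longleftrightarrow> (\<exists>(j::int) (k::int). y $ 1 / T = x $ 1 / T + j \<and>
        (y $ 2 - \<gamma>1 * (y $ 1 / T)) / \<gamma>2 = (x $ 2 - \<gamma>1 * (x $ 1 / T)) / \<gamma>2 + k)"
      unfolding \<Phi>_def prod.inject cis by blast
    also have "\<dots> \<longleftrightarrow> (\<exists>(j::int) (k::int). (y - x) $ 1 = j * T \<and> (y - x) $ 2 = j * \<gamma>1 + k * \<gamma>2)"
      using 1 2 by metis
    finally show ?thesis unfolding mem_lattice_iff .
  qed
  have \<Phi>_range: "range \<Phi> = topspace torus_topology"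
  proof
    show "range \<Phi> \<subseteq> topspace torus_topology" by (auto simp: \<Phi>_def torus_topology_def)
    show "topspace torus_topology \<subseteq> range \<Phi>"
    proof
      fix p assume "p \<in> topspace torus_topology"
      then obtain z w where p: "p = (z, w)" "norm z = 1" "norm w = 1" by (auto simp: torus_topology_def)
      have cis: "cis (Arg z) = z" if "norm z = 1" for z
        using that cis_Arg[of z] by (force simp: sgn_div_norm)
      define x :: "real^2" where
        "x = vector [T * (Arg z / (2 * pi)), \<gamma>1 * (Arg z / (2 * pi)) + \<gamma>2 * (Arg w / (2 * pi))]"
      have "\<Phi> x = (cis (Arg z), cis (Arg w))"
        using T \<gamma>2 unfolding \<Phi>_def x_def by simp
      then show "p \<in> range \<Phi>" using p cis by (metis rangeI)
    qed
  qed
  have \<Phi>_cont: "continuous_map euclidean torus_topology \<Phi>"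
  proof -
    have "continuous_on UNIV (\<lambda>x :: real^2. cis (2 * pi * (x $ 1 / T)))"
      "continuous_on UNIV (\<lambda>x :: real^2. cis (2 * pi * ((x $ 2 - \<gamma>1 * (x $ 1 / T)) / \<gamma>2)))"
      using T \<gamma>2 by (intro continuous_intros; simp)+
    then show ?thesis
      unfolding torus_topology_def \<Phi>_def continuous_map_pairwise o_def
      by (auto intro!: continuous_map_into_subtopology)
  qed
  have compact: "compact_space M"
  proof -
    \<comment> \<open>The second side is symmetric about \<open>0\<close> because \<open>\<gamma>2\<close> may be negative.\<close>
    define K :: "(real^2) set" where "K = cbox (vector [0, - \<bar>\<gamma>2\<bar>]) (vector [T, \<bar>\<gamma>2\<bar>])"
    have "\<exists>y\<in>K. x - y \<in> ?\<Gamma>" for x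
    proof -
      define j where "j = \<lfloor>x $ 1 / T\<rfloor>"
      define k where "k = \<lfloor>(x $ 2 - j * \<gamma>1) / \<gamma>2\<rfloor>"
      define y :: "real^2" where "y = vector [x $ 1 - j * T, x $ 2 - j * \<gamma>1 - k * \<gamma>2]"
      have "j \<le> x $ 1 / T" "x $ 1 / T \<le> j + 1" unfolding j_def by linarith+
      then have y1: "0 \<le> y $ 1" "y $ 1 \<le> T"
        using T by (simp_all add: y_def pos_le_divide_eq pos_divide_le_eq distrib_right)
      have "\<bar>(x $ 2 - j * \<gamma>1) / \<gamma>2 - k\<bar> \<le> 1" unfolding k_def by linarith
      then have "\<bar>(x $ 2 - j * \<gamma>1) / \<gamma>2 - k\<bar> * \<bar>\<gamma>2\<bar> \<le> 1 * \<bar>\<gamma>2\<bar>" by (intro mult_right_mono) auto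
      moreover have "y $ 2 = ((x $ 2 - j * \<gamma>1) / \<gamma>2 - k) * \<gamma>2"
        using \<gamma>2 by (simp add: y_def field_simps)
      ultimately have y2: "\<bar>y $ 2\<bar> \<le> \<bar>\<gamma>2\<bar>" by (simp add: abs_mult)
      have "y \<in> K" using y1 y2 by (auto simp: K_def mem_box_cart forall_2 abs_le_iff)
      moreover have "x - y \<in> ?\<Gamma>"
        unfolding mem_lattice_iff by (intro exI[of _ j] exI[of _ k]) (simp add: y_def)
      ultimately show ?thesis by blast
    qed
    then have "\<pi> x \<in> \<pi> ` K" for x using coset_proj_eq_iff by (metis image_eqI)
    then have "range \<pi> = \<pi> ` K" by blast
    moreover have "compactin M (\<pi> ` K)"
      by (rule image_compactin[OF _ continuous_map_coset_proj]) (simp add: K_def)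
    ultimately show ?thesis by (simp add: compact_space_def topspace_quotient_plane)
  qed
  have \<Phi>_cong: "\<Phi> x = \<Phi> y" if "x \<in> topspace euclidean" "y \<in> topspace euclidean" "\<pi> x = \<pi> y" for x y
    using that(3) by (simp only: \<Phi>_eq_iff coset_proj_eq_iff)
  obtain \<Psi> where \<Psi>: "continuous_map M torus_topology \<Psi>" "\<Psi> ` topspace M = \<Phi> ` topspace euclidean"
    "\<And>x. \<Psi> (\<pi> x) = \<Phi> x"
  proof (rule quotient_map_lift_exists[OF quotient_map_coset_proj \<Phi>_cont \<Phi>_cong])
    fix g assume "continuous_map M torus_topology g" "g ` topspace M = \<Phi> ` topspace euclidean"
      "\<And>x. x \<in> topspace euclidean \<Longrightarrow> g (\<pi> x) = \<Phi> x"
    then show thesis by (intro that) simp_all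
  qed
  have "inj_on \<Psi> (topspace M)"
  proof (rule inj_onI)
    fix C D assume "C \<in> topspace M" "D \<in> topspace M" "\<Psi> C = \<Psi> D"
    moreover then obtain x y where "C = \<pi> x" "D = \<pi> y" unfolding topspace_quotient_plane by blast
    ultimately show "C = D" using \<Psi>(3) \<Phi>_eq_iff coset_proj_eq_iff by simp
  qed
  then have "homeomorphic_map M torus_topology \<Psi>"
    using continuous_imp_homeomorphic_map[OF \<Psi>(1) compact Hausdorff_space_torus] \<Psi>(2) \<Phi>_range by simp
  then show ?thesis by (rule homeomorphic_map_imp_homeomorphic_space)
qed

section \<open>The plane with a warped metric\<close>

lemma smooth_surface_plane: "smooth_surface euclidean plane_atlas"
proof -
  have "second_countable (euclidean :: (real^2) topology)"
    by (rule second_countable_plane)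
  moreover have "connected_space (euclidean :: (real^2) topology)"
    using connectedin_topspace[of "euclidean :: (real^2) topology"] connected_UNIV[where 'a = "real^2"] by simp
  moreover have "smooth_map_on UNIV (id :: real^2 \<Rightarrow> real^2)"
    by (rule smooth_map_on_locally_translation[of "{0}"])
      (auto simp: locally_translation_on_def intro!: exI[of _ UNIV])
  ultimately show ?thesis
    unfolding smooth_surface_def plane_atlas_def by (simp add: inv_id)
qed

lemma riemannian_metric_plane:
  assumes smooth: "\<And>S i j. smooth_on S (\<lambda>x. \<sigma> x $ i $ j)"
    and symmetric: "\<And>x. transpose (\<sigma> x) = \<sigma> x"
    and pos: "\<And>x v. v \<noteq> 0 \<Longrightarrow> 0 < v \<bullet> (\<sigma> x *v v)"
  shows "riemannian_metric plane_atlas (plane_metric \<sigma>)"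
proof -
  have "locally_translation_on {0} UNIV (id :: real^2 \<Rightarrow> real^2)"
    by (auto simp: locally_translation_on_def intro!: exI[of _ UNIV])
  then have "pullback_metric id \<sigma> x = \<sigma> x" for x
    by (rule pullback_metric_locally_translation) auto
  then show ?thesis
    unfolding riemannian_metric_def plane_atlas_def plane_metric_def
    using assms by (simp add: inv_id)
qed

lemma transpose_warped_metric: "transpose (warped_metric f x) = warped_metric f x"
  by (simp add: warped_metric_def transpose_def vec_eq_iff forall_2)

lemma warped_metric_positive:
  assumes "0 < f (x $ 1)" and "v \<noteq> 0"
  shows "0 < v \<bullet> (warped_metric f x *v v)"
proof -
  have "v \<bullet> (warped_metric f x *v v) = (v $ 1)\<^sup>2 + (f (x $ 1) * v $ 2)\<^sup>2"
    by (simp add: warped_metric_def inner_vec_def matrix_vector_mult_def sum_2 power2_eq_square)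
  moreover have "v $ 1 \<noteq> 0 \<or> f (x $ 1) * v $ 2 \<noteq> 0" using assms by (auto simp: vec_eq_iff forall_2)
  ultimately show ?thesis by (simp add: sum_power2_gt_zero_iff)
qed

lemma warped_metric_lattice_invariant:
  assumes "\<And>s. f (s + T) = f s" and "\<gamma> \<in> lattice T \<gamma>1 \<gamma>2"
  shows "warped_metric f (x + \<gamma>) = warped_metric f x"
proof -
  interpret periodic_fun_simple f T by unfold_locales (rule assms)
  obtain j :: int where "\<gamma> $ 1 = j * T" using assms(2) unfolding mem_lattice_iff by blast
  then have "f ((x + \<gamma>) $ 1) = f (x $ 1)" by (simp add: plus_of_int)
  then show ?thesis by (simp add: warped_metric_def)
qed

lemma warped_plane_generalized_ricci_surface:
  assumes sol: "periodic_solution a c m l f T"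
  shows "generalized_ricci_surface a 0 c euclidean plane_atlas (plane_metric (warped_metric f))"
    and "rotational_symmetry (warped_metric f)"
proof -
  have pos: "0 < f s" and f1: "(f has_real_derivative deriv f s) (at s)"
    and f2: "(deriv f has_real_derivative m * f s powr (1 - a) - c * f s) (at s)" for s
    using sol by (auto simp: periodic_solution_def)
  have f2': "(deriv f has_real_derivative m * f s powr (1 - a) + (- c) * f s) (at s)" for s
    using f2[of s] by simp
  have "riemannian_metric plane_atlas (plane_metric (warped_metric f))"
    by (rule riemannian_metric_plane[OF smooth_on_warped_metric[OF pos f1 f2'] transpose_warped_metric
          warped_metric_positive[of f, OF pos]])
  then show "generalized_ricci_surface a 0 c euclidean plane_atlas (plane_metric (warped_metric f))"
    using smooth_surface_plane ricci_equation_warped_metric[OF pos f1 f2]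
    by (simp add: generalized_ricci_surface_def plane_metric_def case_prod_beta)
  show "rotational_symmetry (warped_metric f)"
    using pos unfolding rotational_symmetry_def by blast
qed

lemma warped_quotient_generalized_ricci_torus:
  assumes sol: "periodic_solution a c m l f T" and \<gamma>2: "\<gamma>2 \<noteq> 0" and \<Gamma>: "\<Gamma> = lattice T \<gamma>1 \<gamma>2"
  shows "local_isometry euclidean plane_atlas (plane_metric (warped_metric f))
      (quotient_plane \<Gamma>) (quotient_atlas \<Gamma>) (quotient_metric (warped_metric f)) (coset_proj \<Gamma>)"
    and "generalized_ricci_torus a 0 c
      (quotient_plane \<Gamma>) (quotient_atlas \<Gamma>) (quotient_metric (warped_metric f))"
proof -
  have pos: "0 < f s" and f1: "(f has_real_derivative deriv f s) (at s)"
    and f2: "(deriv f has_real_derivative m * f s powr (1 - a) - c * f s) (at s)"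
    and T: "0 < T" and period: "f (s + T) = f s" for s
    using sol by (auto simp: periodic_solution_def minimal_period_def)
  have f2': "(deriv f has_real_derivative m * f s powr (1 - a) + (- c) * f s) (at s)" for s
    using f2[of s] by simp
  interpret translation_group \<Gamma> unfolding \<Gamma> by (rule translation_group_lattice)
  have homeo: "M homeomorphic_space torus_topology"
    unfolding \<Gamma> by (rule quotient_plane_lattice_homeomorphic_torus[OF T \<gamma>2])
  have haus: "Hausdorff_space M"
    using homeomorphic_Hausdorff_space[OF homeo] Hausdorff_space_torus by simp
  have invariant: "warped_metric f (x + \<gamma>) = warped_metric f x" if "\<gamma> \<in> \<Gamma>" for x \<gamma>
    using that unfolding \<Gamma> by (rule warped_metric_lattice_invariant[where f = f, OF period])
  show "local_isometry euclidean plane_atlas (plane_metric (warped_metric f))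
      M (quotient_atlas \<Gamma>) (quotient_metric (warped_metric f)) \<pi>"
    by (rule local_isometry_coset_proj[OF invariant])
  have "smooth_surface M (quotient_atlas \<Gamma>)"
    by (rule smooth_surface_quotient_plane[OF haus, of "min T \<bar>\<gamma>2\<bar>"])
      (use T \<gamma>2 lattice_discrete[OF T \<gamma>2] in \<open>simp_all add: \<Gamma>\<close>)
  moreover have "riemannian_metric (quotient_atlas \<Gamma>) (quotient_metric (warped_metric f))"
    by (rule riemannian_metric_quotient[OF smooth_on_warped_metric[OF pos f1 f2'] transpose_warped_metric
          warped_metric_positive[of f, OF pos] invariant])
  ultimately show "generalized_ricci_torus a 0 c M (quotient_atlas \<Gamma>) (quotient_metric (warped_metric f))"
    using homeo ricci_equation_warped_metric[OF pos f1 f2]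
    by (simp add: generalized_ricci_torus_def generalized_ricci_surface_def quotient_metric_def case_prod_beta)
qed

theorem proposition3p2:
  fixes a c :: real
  assumes "a \<noteq> 0" and "c \<noteq> 0" and "a * c > 0"
  shows "\<forall>m l. admissible a c m l \<longrightarrow>
    (\<exists>f T. periodic_solution a c m l f T) \<and>
    (\<forall>f1 T1 f2 T2. periodic_solution a c m l f1 T1 \<and> periodic_solution a c m l f2 T2 \<longrightarrow>
       T1 = T2 \<and> (\<exists>s0. \<forall>s. f2 s = f1 (s + s0))) \<and>
    (\<forall>f T. periodic_solution a c m l f T \<longrightarrow>
       generalized_ricci_surface a 0 c euclidean plane_atlas (plane_metric (warped_metric f)) \<and>
       rotational_symmetry (warped_metric f) \<and>
       (\<forall>\<gamma>1 \<gamma>2. \<gamma>2 \<noteq> 0 \<longrightarrow>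
          (let \<Gamma> = lattice T \<gamma>1 \<gamma>2 in
             local_isometry
               euclidean plane_atlas (plane_metric (warped_metric f))
               (quotient_plane \<Gamma>) (quotient_atlas \<Gamma>) (quotient_metric (warped_metric f))
               (coset_proj \<Gamma>) \<and>
             generalized_ricci_torus a 0 c
               (quotient_plane \<Gamma>) (quotient_atlas \<Gamma>) (quotient_metric (warped_metric f)))))"
  unfolding Let_def
  using periodic_solution_exists[OF assms(3)] periodic_solution_unique[OF assms(3)]
    warped_plane_generalized_ricci_surface warped_quotient_generalized_ricci_torus[OF _ _ refl]
  by (intro allI impI conjI) blast+

end
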